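(* Let $\mathcal H$ be a real Hilbert space, $m\ge2$ an integer and $f_i\in\Gamma(\mathcal H)$ for $i=1,\dots,m$. Consider the problem $$(P^{\Sigma})\quad \inf_{x\in\mathcal H}\Big\{\sum_{i=1}^m f_i(x)\Big\}$$ and its Fenchel-type dual $$(D^{\Sigma})\quad \sup_{\substack{v_1,\dots,v_m\in\mathcal H\\ \sum_{i=1}^m v_i=0}}\Big\{-\sum_{i=1}^m f_i^*(v_i)\Big\},$$ with optimal objective values $v(P^{\Sigma})$ and $v(D^{\Sigma})$, respectively. Suppose that $(P^{\Sigma})$ has an optimal solution and that $$0\in\operatorname{sqri}\Big(\prod_{i=1}^m\operatorname{dom} f_i-\{(x,\dots,x):x\in\mathcal H\}\Big).$$ Let $y_i^0,y_i^1,z_i^0,z_i^1\in\mathcal H$, $i=1,\dots,m$, let $\gamma>0$, let $(\alpha_k)_{k\ge1}$ be a nondecreasing real sequence with $0\le\alpha_k\le\alpha<1$ for every $k\ge2$, and let $(\lambda_k)_{k\ge1}$ be a real sequence and $\lambda,\sigma,\delta>0$ be such that $$\delta>\frac{\alpha^2(1+\alpha)+\alpha\sigma}{1-\alpha^2}\quad\text{and}\quad 0<\lambda\le\lambda_k\le 2\cdot\frac{\delta-\alpha[\alpha(1+\alpha)+\alpha\delta+\sigma]}{\delta[1+\alpha(1+\alpha)+\alpha\delta+\sigma]}\quad\forall k\ge2.$$ Suppose that either $\alpha_2=0$ or $\lambda_1=\alpha_1=0$. For every $k\ge1$ define (for $i=1,\dots,m$ where $i$ appears as a free index) $$x^{k+1}=\frac1m\sum_{i=1}^m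 z_i^k-\frac{1}{m\gamma}\sum_{i=1}^m y_i^k+\frac{\alpha_k}{m\gamma}\sum_{i=1}^m\big(y_i^k-y_i^{k-1}+\gamma(z_i^k-z_i^{k-1})\big),$$ $$\overline z_i^{k+1}=\alpha_{k+1}\lambda_k(x^{k+1}-z_i^k)+\frac{(1-\lambda_k)\alpha_k\alpha_{k+1}}{\gamma}\big(y_i^k-y_i^{k-1}+\gamma(z_i^k-z_i^{k-1})\big),$$ $$z_i^{k+1}=\operatorname*{argmin}_{z\in\mathcal H}\Big\{f_i(z+\overline z_i^{k+1})+\big\langle -y_i^k-(1-\lambda_k)\alpha_k\big(y_i^k-y_i^{k-1}+\gamma(z_i^k-z_i^{k-1})\big),z\big\rangle+\tfrac{\gamma}{2}\|z-\lambda_kx^{k+1}-(1-\lambda_k)z_i^k\|^2\Big\},$$ $$y_i^{k+1}=y_i^k+\gamma\big(\lambda_kx^{k+1}+(1-\lambda_k)z_i^k-z_i^{k+1}\big)+(1-\lambda_k)\alpha_k\big(y_i^k-y_i^{k-1}+\gamma(z_i^k-z_i^{k-1})\big).$$ Then there exists $(\overline x,\overline v_1,\dots,\overline v_m)\in\mathcal H\times\mathcal H^m$ satisfying $$\overline v_i\in\partial f_i(\overline x),\ i=1,\dots,m,\quad\text{and}\quad \sum_{i=1}^m\overline v_i=0$$ (hence $\overline x$ is an optimal solution to $(P^{\Sigma})$, $(\overline v_1,\dots,\overline v_m)$ is an optimal solution to $(D^{\Sigma})$ and $v(P^{\Sigma})=v(D^{\Sigma})$), such that the following statements are true: (i) $(x^k)_{k\ge2}$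 converges weakly to $\overline x$; (ii) $(\overline z_i^k)_{k\ge2}$ converges strongly to $0$, $i=1,\dots,m$; (iii) $(z_i^k)_{k\in\mathbb N}$ converges weakly to $\overline x$, $i=1,\dots,m$; (iv) $(x^{k+1}-z_i^k)_{k\ge2}$ converges strongly to $0$, $i=1,\dots,m$; (v) $(y_i^k)_{k\in\mathbb N}$ converges weakly to $\overline v_i$, $i=1,\dots,m$; (vi) if $f_i^*$ is strongly convex for $i=1,\dots,m$, then $(y_1^k,\dots,y_m^k)_{k\in\mathbb N}$ converges strongly to the unique optimal solution to $(D^{\Sigma})$; (vii) $\lim_{k\to+\infty}\sum_{i=1}^m f_i(z_i^k+\overline z_i^k)=v(P^{\Sigma})=v(D^{\Sigma})=\lim_{k\to+\infty}\big(-\sum_{i=1}^m f_i^*(y_i^k)\big)$.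
   Context: $\Gamma(\mathcal H)$ denotes the family of proper, convex, lower semicontinuous functions $\mathcal H\to\mathbb R\cup\{\pm\infty\}$ (proper: never $-\infty$ and not identically $+\infty$). $\operatorname{dom} f=\{x: f(x)<+\infty\}$; $f^*(u)=\sup_{x}\{\langle u,x\rangle-f(x)\}$ is the conjugate; $\partial f(x)=\{v: f(y)\ge f(x)+\langle v,y-x\rangle\ \forall y\}$ if $f(x)\in\mathbb R$ and $\partial f(x)=\varnothing$ otherwise. $\mathbb N=\{0,1,2,\dots\}$. The product space $\mathcal H^m$ carries the inner product $\langle x,u\rangle=\sum_{i=1}^m\langle x_i,u_i\rangle$ and the associated norm. For a convex set $S$ in a Hilbert space, the strong quasi-relative interior is $\operatorname{sqri}S=\{x\in S:\bigcup_{\lambda>0}\lambda(S-x)\text{ is a closed linear subspace}\}$; in this theorem it is taken in $\mathcal H^m$. A proper function $h$ is strongly convex if, for some $\beta>0$, $h(tx+(1-t)y)+t(1-t)\frac{\beta}{2}\|x-y\|^2\le th(x)+(1-t)h(y)$ for all $x,y\in\operatorname{dom}h$ and $t\in(0,1)$. *)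

theory Defs
  imports "HOL-Analysis.Analysis"
begin

definition proper_fun :: "('a \<Rightarrow> ereal) \<Rightarrow> bool" where
  "proper_fun f \<longleftrightarrow> (\<forall>x. f x \<noteq> -\<infinity>) \<and> (\<exists>x. f x \<noteq> \<infinity>)"

definition edom :: "('a \<Rightarrow> ereal) \<Rightarrow> 'a set" where
  "edom f = {x. f x < \<infinity>}"

text \<open>Only open \<open>t \<in> (0,1)\<close> are considered, so no product \<open>0 * \<infinity>\<close> arises; the right-hand side
  is unambiguous whenever \<open>f\<close> never takes the value \<open>-\<infinity>\<close>.\<close>

definition econvex :: "('a::real_vector \<Rightarrow> ereal) \<Rightarrow> bool" where
  "econvex f \<longleftrightarrow> (\<forall>x y. \<forall>t\<in>{0<..<1}.
     f (t *\<^sub>R x + (1 - t) *\<^sub>R y) \<le> ereal t * f x + ereal (1 - t) * f y)"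

definition lower_semicont :: "('a::topological_space \<Rightarrow> ereal) \<Rightarrow> bool" where
  "lower_semicont f \<longleftrightarrow> (\<forall>x. f x \<le> Liminf (at x) f)"

definition Gamma_class :: "('a::real_normed_vector \<Rightarrow> ereal) set" where
  "Gamma_class = {f. proper_fun f \<and> econvex f \<and> lower_semicont f}"

definition conjugate :: "('a::real_inner \<Rightarrow> ereal) \<Rightarrow> 'a \<Rightarrow> ereal" where
  "conjugate f u = (SUP x. ereal (u \<bullet> x) - f x)"

definition subdiff :: "('a::real_inner \<Rightarrow> ereal) \<Rightarrow> 'a \<Rightarrow> 'a set" where
  "subdiff f x = {v. \<bar>f x\<bar> \<noteq> \<infinity> \<and> (\<forall>y. f x + ereal (v \<bullet> (y - x)) \<le> f y)}"

definition strongly_convex :: "('a::real_normed_vector \<Rightarrow> ereal) \<Rightarrow> bool" where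
  "strongly_convex h \<longleftrightarrow> proper_fun h \<and> (\<exists>\<beta>>0. \<forall>x\<in>edom h. \<forall>y\<in>edom h. \<forall>t\<in>{0<..<1}.
     h (t *\<^sub>R x + (1 - t) *\<^sub>R y) + ereal (t * (1 - t) * (\<beta> / 2) * (norm (x - y))\<^sup>2)
       \<le> ereal t * h x + ereal (1 - t) * h y)"

definition sqri :: "'a::real_normed_vector set \<Rightarrow> 'a set" where
  "sqri S = {x \<in> S. let C = (\<Union>c\<in>{0<..}. {c *\<^sub>R (s - x) |s. s \<in> S}) in closed C \<and> subspace C}"

definition weakly_converges :: "(nat \<Rightarrow> 'a::real_inner) \<Rightarrow> 'a \<Rightarrow> bool" where
  "weakly_converges X l \<longleftrightarrow> (\<forall>u. (\<lambda>k. X k \<bullet> u) \<longlonglongrightarrow> l \<bullet> u)"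

text \<open>The product space \<open>H\<^sup>m\<close> is \<^typ>\<open>'a ^ 'm\<close>, with \<open>m = CARD('m)\<close>. Its library inner product and
  norm are the ones induced by the componentwise inner products.\<close>

definition primal_value :: "('m::finite \<Rightarrow> 'a::real_inner \<Rightarrow> ereal) \<Rightarrow> ereal" where
  "primal_value f = (INF x. \<Sum>i\<in>UNIV. f i x)"

definition dual_value :: "('m::finite \<Rightarrow> 'a::real_inner \<Rightarrow> ereal) \<Rightarrow> ereal" where
  "dual_value f =
     (SUP v\<in>{v :: 'a ^ 'm. (\<Sum>i\<in>UNIV. v $ i) = 0}. - (\<Sum>i\<in>UNIV. conjugate (f i) (v $ i)))"

definition primal_optimal :: "('m::finite \<Rightarrow> 'a::real_inner \<Rightarrow> ereal) \<Rightarrow> 'a \<Rightarrow> bool" where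
  "primal_optimal f x \<longleftrightarrow> (\<Sum>i\<in>UNIV. f i x) = primal_value f"

definition dual_optimal :: "('m::finite \<Rightarrow> 'a::real_inner \<Rightarrow> ereal) \<Rightarrow> 'a ^ 'm \<Rightarrow> bool" where
  "dual_optimal f v \<longleftrightarrow>
     (\<Sum>i\<in>UNIV. v $ i) = 0 \<and> - (\<Sum>i\<in>UNIV. conjugate (f i) (v $ i)) = dual_value f"

end

theory Submission
  imports Defs
begin

text \<open>Put \<open>F u = (\<Sum>i. f i (u $ i))\<close> on \<open>H\<^sup>m\<close>, let \<open>Pr\<close> be the projection onto the diagonal, and let
  \<open>w k = z k + y k / \<gamma>\<close>, \<open>s k = w k + \<alpha>s k *\<^sub>R (w k - w (k - 1))\<close> and \<open>p k = z k + zbar k\<close>. For \<open>k \<ge> 2\<close> the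
  algorithm says that \<open>p k\<close> is the proximal point of \<open>F\<close> at \<open>s k\<close>, that \<open>y k = \<gamma> (s k - p k) \<in> \<partial>F (p k)\<close>,
  that \<open>x (k + 1)\<close> is the diagonal entry of \<open>Pr (2 p k - s k)\<close>, and that
  \<open>w (k + 1) = s k + lam k (Pr (2 p k - s k) - p k)\<close>. This is an inertial Krasnoselskii--Mann iteration
  with relaxation \<open>lam k / 2\<close> for the nonexpansive map \<open>s \<mapsto> (2 Pr - 1) (2 prox - 1) s\<close>. A Lyapunov function
  shows that its increments vanish and that the distances to fixed points converge.

  Weak compactness is avoided by asymptotic centers: they exist by completeness, the asymptotic center of an
  asymptotically regular sequence is a fixed point, and if all subsequences share their center then
  the sequence converges weakly to it. Since \<open>Pr\<close> is weakly continuous, \<open>Pr (y k) \<longlonglongrightarrow> 0\<close> and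
  \<open>p k - Pr (p k) \<longlonglongrightarrow> 0\<close>, the weak limit of \<open>s k\<close> determines those of \<open>p k\<close> and \<open>y k\<close>, and the inner
  products \<open>y k \<bullet> (p k - p)\<close> vanish, which gives the values and, under strong convexity, strong convergence.
  A fixed point exists by the sum rule of Attouch and Brezis, where the interiority condition enters.\<close>

section \<open>Lower semicontinuous convex functions\<close>

lemma lower_semicont_iff_liminf:
  fixes f :: "'a::first_countable_topology \<Rightarrow> ereal"
  shows "lower_semicont f \<longleftrightarrow> (\<forall>X l. X \<longlonglongrightarrow> l \<longrightarrow> f l \<le> liminf (\<lambda>n. f (X n)))"
proof (intro iffI allI impI)
  fix X and l :: 'a assume f: "lower_semicont f" and X: "X \<longlonglongrightarrow> l"
  show "f l \<le> liminf (\<lambda>n. f (X n))"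
    unfolding le_Liminf_iff
  proof (intro allI impI)
    fix y assume y: "y < f l"
    then have "eventually (\<lambda>u. y < f u) (at l)"
      using f unfolding lower_semicont_def le_Liminf_iff by blast
    \<comment> \<open>\<open>Liminf\<close> along \<open>at l\<close> does not see \<open>l\<close>
      itself; \<open>y < f l\<close> supplies that point.\<close>
    then have "eventually (\<lambda>u. y < f u) (nhds l)"
      using y by (auto simp: eventually_at_filter elim: eventually_mono)
    then show "\<forall>\<^sub>F n in sequentially. y < f (X n)"
      using X by (rule eventually_compose_filterlim)
  qed
next
  assume seq: "\<forall>X l. X \<longlonglongrightarrow> l \<longrightarrow> f l \<le> liminf (\<lambda>n. f (X n))"
  show "lower_semicont f"
    unfolding lower_semicont_def le_Liminf_iff
  proof (intro allI impI)
    fix l y assume y: "y < f l"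
    show "\<forall>\<^sub>F u in at l. y < f u"
    proof (rule sequentially_imp_eventually_within, intro allI impI, elim conjE)
      fix X assume "X \<longlonglongrightarrow> l"
      then have "f l \<le> liminf (\<lambda>n. f (X n))" using seq by blast
      then show "\<forall>\<^sub>F n in sequentially. y < f (X n)"
        using y unfolding le_Liminf_iff by blast
    qed
  qed
qed

lemma lower_semicont_limit_le:
  fixes f :: "'a::first_countable_topology \<Rightarrow> ereal"
  assumes "lower_semicont f" "X \<longlonglongrightarrow> l" "(\<lambda>n. ereal (c n)) \<longlonglongrightarrow> ereal C"
    and le: "\<forall>\<^sub>F n in sequentially. f (X n) \<le> ereal (c n)"
  shows "f l \<le> ereal C"
proof -
  have "f l \<le> liminf (\<lambda>n. f (X n))"
    using assms lower_semicont_iff_liminf by blast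
  also have "\<dots> \<le> liminf (\<lambda>n. ereal (c n))"
    using le by (rule Liminf_mono)
  also have "\<dots> = ereal C"
    using assms(3) by (intro lim_imp_Liminf) auto
  finally show ?thesis .
qed

lemma proper_fun_cases:
  assumes "proper_fun f"
  obtains "f x = \<infinity>" | a where "f x = ereal a"
  using assms unfolding proper_fun_def by (cases "f x") auto

lemma proper_fun_real: "proper_fun f \<Longrightarrow> f x \<noteq> \<infinity> \<Longrightarrow> \<exists>a. f x = ereal a"
  unfolding proper_fun_def by (metis ereal_cases)

lemma econvexD_real:
  assumes "econvex f" "f x = ereal a" "f y = ereal b" "0 < t" "t < 1"
  shows "f (t *\<^sub>R x + (1 - t) *\<^sub>R y) \<le> ereal (t * a + (1 - t) * b)"
proof -
  have "f (t *\<^sub>R x + (1 - t) *\<^sub>R y) \<le> ereal t * f x + ereal (1 - t) * f y"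
    using assms(1,4,5) by (simp add: econvex_def)
  then show ?thesis by (simp add: assms(2,3))
qed

text \<open>Lower semicontinuity bounds \<open>F\<close> below on a ball of radius \<open>r\<close>
  about a point of its domain, and convexity along segments leaving that ball limits the rate of
  decrease to \<open>2 / r\<close>. Such a minorant does the work of an affine one without a
  separation theorem.\<close>

lemma Gamma_class_linear_minorant:
  assumes "F \<in> Gamma_class"
  shows "\<exists>A B. B \<ge> 0 \<and> (\<forall>x. ereal (A - B * norm x) \<le> F x)"
proof -
  have P: "proper_fun F" and C: "econvex F" and L: "lower_semicont F"
    using assms by (auto simp: Gamma_class_def)
  obtain x0 a where a: "F x0 = ereal a"
    using P unfolding proper_fun_def by (metis ereal_cases)
  have "ereal (a - 1) < F x0" by (simp add: a)
  then have "eventually (\<lambda>x. ereal (a - 1) < F x) (at x0)"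
    using L unfolding lower_semicont_def le_Liminf_iff by blast
  then obtain r where r: "r > 0" "\<And>x. dist x x0 < r \<Longrightarrow> ereal (a - 1) < F x"
    unfolding eventually_at using \<open>ereal (a - 1) < F x0\<close> by auto metis
  have key: "ereal (a - 1 - 2 / r * norm (x - x0)) \<le> F x" for x
  proof (cases rule: proper_fun_cases[OF P, of x])
    case 1 then show ?thesis by simp
  next
    case (2 b)
    show ?thesis
    proof (cases "norm (x - x0) < r")
      case True
      then have "ereal (a - 1) < F x" using r(2) by (simp add: dist_norm)
      moreover have "0 \<le> 2 / r * norm (x - x0)" using r(1) by simp
      ultimately show ?thesis using 2 by simp
    next
      case False
      define n where "n = norm (x - x0)"
      have n: "n \<ge> r" "n > 0" using False r(1) by (auto simp: n_def)
      \<comment> \<open>This \<open>t\<close> places the point of the segment at distance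
        \<open>r / 2\<close> from \<open>x0\<close>, inside the ball.\<close>
      define t where "t = r / (2 * n)"
      have t: "0 < t" "t < 1" using n r(1) by (auto simp: t_def divide_simps)
      have "(t *\<^sub>R x + (1 - t) *\<^sub>R x0) - x0 = t *\<^sub>R (x - x0)" by (simp add: algebra_simps)
      then have "dist (t *\<^sub>R x + (1 - t) *\<^sub>R x0) x0 = t * n"
        using t by (simp add: dist_norm n_def)
      also have "\<dots> < r" using n r(1) by (simp add: t_def)
      finally have "ereal (a - 1) < F (t *\<^sub>R x + (1 - t) *\<^sub>R x0)" by (rule r(2))
      also have "\<dots> \<le> ereal (t * b + (1 - t) * a)" by (rule econvexD_real[OF C 2 a t])
      finally have "t * (a - b) < 1" by (simp add: algebra_simps)
      then have "a - b < 1 / t" using t by (simp add: field_simps)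
      then have "a - b < 2 / r * n" using n r(1) by (simp add: t_def)
      then show ?thesis by (simp add: 2 n_def[symmetric])
    qed
  qed
  show ?thesis
  proof (intro exI conjI allI)
    show "0 \<le> 2 / r" using r(1) by simp
    fix x
    have "2 / r * norm (x - x0) \<le> 2 / r * (norm x + norm x0)"
      using r(1) by (intro mult_left_mono norm_triangle_ineq4) auto
    then have "ereal ((a - 1 - 2 / r * norm x0) - 2 / r * norm x) \<le> ereal (a - 1 - 2 / r * norm (x - x0))"
      by (simp only: ereal_less_eq distrib_left)
    also have "\<dots> \<le> F x" by (rule key)
    finally show "ereal ((a - 1 - 2 / r * norm x0) - 2 / r * norm x) \<le> F x" .
  qed
qed

text \<open>A minimising sequence is Cauchy, since the midpoint of two almost optimal points that
  are far apart would have a value below the infimum. Both the penalised problems and the asymptotic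
  centers are solved in this way.\<close>

lemma uniformly_convex_has_minimizer:
  fixes G :: "'a::{real_normed_vector, complete_space} \<Rightarrow> ereal"
  assumes lsc: "lower_semicont G"
    and bound: "\<And>x. ereal b \<le> G x" and fin: "\<exists>x. G x < \<infinity>" and \<kappa>: "\<kappa> > 0"
    and conv: "\<And>x y r. G x \<le> ereal r \<Longrightarrow> G y \<le> ereal r \<Longrightarrow>
      G ((1/2) *\<^sub>R (x + y)) \<le> ereal (r - \<kappa> * (norm (x - y))\<^sup>2)"
  shows "\<exists>x. \<forall>y. G x \<le> G y"
proof -
  obtain x0 where "G x0 < \<infinity>" using fin by blast
  then have "(INF x. G x) < \<infinity>" by (meson INF_lower UNIV_I le_less_trans)
  moreover have "ereal b \<le> (INF x. G x)" using bound by (intro INF_greatest)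
  ultimately obtain I where I: "(INF x. G x) = ereal I"
    by (cases "INF x. G x") auto
  have low: "ereal I \<le> G x" for x using I by (metis INF_lower UNIV_I)
  have "\<exists>x. G x \<le> ereal (I + 1 / real (Suc n))" for n
  proof -
    have "(INF x. G x) < ereal (I + 1 / real (Suc n))" by (simp add: I)
    then obtain x where "G x < ereal (I + 1 / real (Suc n))" unfolding INF_less_iff by blast
    then show ?thesis by (intro exI[of _ x]) simp
  qed
  then obtain X where X: "\<And>n. G (X n) \<le> ereal (I + 1 / real (Suc n))" by metis
  have "Cauchy X"
  proof (rule metric_CauchyI)
    fix e :: real assume e: "e > 0"
    obtain N :: nat where N: "N > 0" "1 / real N < \<kappa> * e\<^sup>2"
      using nat_approx_posE[of "\<kappa> * e\<^sup>2"] \<kappa> e by (metis mult_pos_pos zero_less_power zero_less_Suc)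
    show "\<exists>M. \<forall>m\<ge>M. \<forall>n\<ge>M. dist (X m) (X n) < e"
    proof (intro exI allI impI)
      fix m n assume mn: "m \<ge> N" "n \<ge> N"
      have "G (X k) \<le> ereal (I + 1 / real N)" if "k \<ge> N" for k
      proof -
        have "1 / real (Suc k) \<le> 1 / real N" using that N by (intro divide_left_mono) auto
        then show ?thesis by (intro order_trans[OF X[of k]]) simp
      qed
      from conv[OF this[OF mn(1)] this[OF mn(2)]]
      have "ereal I \<le> ereal (I + 1 / real N - \<kappa> * (norm (X m - X n))\<^sup>2)"
        using low order_trans by blast
      then have "\<kappa> * (norm (X m - X n))\<^sup>2 < \<kappa> * e\<^sup>2" using N by simp
      then have "(norm (X m - X n))\<^sup>2 < e\<^sup>2" using \<kappa> by simp
      then show "dist (X m) (X n) < e"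
        using e by (simp add: dist_norm power2_less_imp_less)
    qed
  qed
  then obtain l where l: "X \<longlonglongrightarrow> l" using Cauchy_convergent_iff convergent_def by blast
  have "(\<lambda>n. I + 1 / real (Suc n)) \<longlonglongrightarrow> I + 0"
    by (intro tendsto_intros lim_1_over_n[THEN LIMSEQ_Suc])
  then have "G l \<le> ereal I"
    using lower_semicont_limit_le[OF lsc l, of "\<lambda>n. I + 1 / real (Suc n)" I] X by simp
  then show ?thesis using low order_trans by blast
qed

text \<open>Fermat's rule: compare \<open>x\<close> with a point at parameter \<open>t\<close> on
  the segment to \<open>z\<close>, use convexity of \<open>F\<close>, divide by \<open>t\<close> and
  let \<open>t\<close> tend to 0. The bound on \<open>q\<close> says one-sidedly that
  \<open>g\<close> is its gradient at \<open>x\<close>.\<close>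

lemma smooth_minimizer_subgradient:
  fixes F :: "'a::real_inner \<Rightarrow> ereal"
  assumes P: "proper_fun F" and C: "econvex F"
    and min: "\<And>z. F x + ereal (q x) \<le> F z + ereal (q z)"
    and q: "\<And>h. q (x + h) \<le> q x + g \<bullet> h + K * (norm h)\<^sup>2"
  shows "- g \<in> subdiff F x"
proof -
  obtain z0 a0 where a0: "F z0 = ereal a0"
    using P unfolding proper_fun_def by (metis ereal_cases)
  have "F x \<noteq> \<infinity>" using min[of z0] a0 by auto
  then obtain a where a: "F x = ereal a" using proper_fun_cases[OF P] by metis
  have "ereal (a + - g \<bullet> (z - x)) \<le> F z" for z
  proof (cases rule: proper_fun_cases[OF P, of z])
    case 1 then show ?thesis by simp
  next
    case (2 b)
    define h where "h = z - x"
    have step: "0 \<le> (b - a + g \<bullet> h) + t * (K * (norm h)\<^sup>2)" if t: "0 < t" "t < 1" for t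
    proof -
      have eq: "t *\<^sub>R z + (1 - t) *\<^sub>R x = x + t *\<^sub>R h" by (simp add: h_def algebra_simps)
      have "ereal (a + q x) \<le> F (x + t *\<^sub>R h) + ereal (q (x + t *\<^sub>R h))"
        using min[of "x + t *\<^sub>R h"] a by simp
      also have "\<dots> \<le> ereal (t * b + (1 - t) * a) + ereal (q (x + t *\<^sub>R h))"
        using econvexD_real[OF C 2 a t] by (intro add_right_mono) (simp add: eq)
      finally have "a + q x \<le> t * b + (1 - t) * a + q (x + t *\<^sub>R h)" by simp
      also have "\<dots> \<le> t * b + (1 - t) * a + (q x + g \<bullet> (t *\<^sub>R h) + K * (norm (t *\<^sub>R h))\<^sup>2)"
        using q by (intro add_left_mono)
      finally have "0 \<le> t * ((b - a + g \<bullet> h) + t * (K * (norm h)\<^sup>2))"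
        by (simp add: algebra_simps power2_eq_square)
      then show ?thesis using t by (simp add: zero_le_mult_iff)
    qed
    have "((\<lambda>t. (b - a + g \<bullet> h) + t * (K * (norm h)\<^sup>2)) \<longlongrightarrow> (b - a + g \<bullet> h) + 0 * (K * (norm h)\<^sup>2)) (at_right 0)"
      by (intro tendsto_intros)
    moreover have "\<forall>\<^sub>F t in at_right 0. 0 \<le> (b - a + g \<bullet> h) + t * (K * (norm h)\<^sup>2)"
      using eventually_at_right[OF zero_less_one[where 'a=real]] step by (auto intro!: exI[of _ 1])
    ultimately have "0 \<le> b - a + g \<bullet> h"
      using tendsto_lowerbound[OF _ _ trivial_limit_at_right_real] by fastforce
    then show ?thesis using 2 by (simp add: h_def)
  qed
  then show ?thesis by (simp add: subdiff_def a)
qed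

section \<open>Orthogonal projections\<close>

text \<open>An idempotent self-adjoint linear map is the orthogonal projection onto its range.
  Encoded this way, the subspace is given by \<open>Pr x = x\<close> and its complement by
  \<open>Pr x = 0\<close>.\<close>

locale orthogonal_projection =
  fixes Pr :: "'h::{real_inner, complete_space} \<Rightarrow> 'h"
  assumes linear: "linear Pr"
    and idem: "Pr (Pr x) = Pr x"
    and selfadjoint: "Pr x \<bullet> y = x \<bullet> Pr y"
begin

lemma add: "Pr (x + y) = Pr x + Pr y" by (rule linear_add[OF linear])
lemma diff: "Pr (x - y) = Pr x - Pr y" by (rule linear_diff[OF linear])
lemma scale: "Pr (c *\<^sub>R x) = c *\<^sub>R Pr x" by (rule linear_scale[OF linear])

lemma inner_split: "x \<bullet> y = Pr x \<bullet> Pr y + (x - Pr x) \<bullet> (y - Pr y)"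
proof -
  have "Pr x \<bullet> Pr y = x \<bullet> Pr y" "Pr x \<bullet> y = x \<bullet> Pr y" by (simp_all only: selfadjoint idem)
  then show ?thesis by (simp add: inner_diff_left inner_diff_right)
qed

lemma norm_split: "(norm x)\<^sup>2 = (norm (Pr x))\<^sup>2 + (norm (x - Pr x))\<^sup>2"
  unfolding power2_norm_eq_inner by (rule inner_split)

lemma norm_le: "norm (Pr x) \<le> norm x"
  by (rule power2_le_imp_le) (simp_all add: norm_split[of x])

lemma norm_diff_le: "norm (x - Pr x) \<le> norm x"
  by (rule power2_le_imp_le) (simp_all add: norm_split[of x])

lemma norm_reflection: "norm (2 *\<^sub>R Pr x - x) = norm x"
proof -
  have "Pr x \<bullet> Pr x = x \<bullet> Pr x" by (simp only: selfadjoint idem)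
  then have "(norm (2 *\<^sub>R Pr x - x))\<^sup>2 = (norm x)\<^sup>2"
    unfolding power2_norm_eq_inner by (simp add: inner_diff_left inner_diff_right inner_commute)
  then show ?thesis by (simp add: power2_eq_iff_nonneg)
qed

lemma bounded_linear: "bounded_linear Pr"
  using norm_le by (intro bounded_linear_intro[where K=1]) (auto simp: add scale)

lemmas tendsto = bounded_linear.tendsto[OF bounded_linear]

lemma inner_range_kernel: "Pr x = x \<Longrightarrow> Pr y = 0 \<Longrightarrow> x \<bullet> y = 0"
  by (metis selfadjoint inner_zero_right)

end

section \<open>Existence of penalised minimisers\<close>

lemma lower_semicont_add:
  fixes f g :: "'a::first_countable_topology \<Rightarrow> ereal"
  assumes f: "lower_semicont f" "\<And>x. f x \<noteq> -\<infinity>" and g: "lower_semicont g" "\<And>x. g x \<noteq> -\<infinity>"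
  shows "lower_semicont (\<lambda>x. f x + g x)"
  unfolding lower_semicont_iff_liminf
proof (intro allI impI)
  fix X and l :: 'a assume X: "X \<longlonglongrightarrow> l"
  have le: "f l \<le> liminf (\<lambda>n. f (X n))" "g l \<le> liminf (\<lambda>n. g (X n))"
    using f(1) g(1) X unfolding lower_semicont_iff_liminf by auto
  then have "f l + g l \<le> liminf (\<lambda>n. f (X n)) + liminf (\<lambda>n. g (X n))"
    by (rule add_mono)
  also have "\<dots> \<le> liminf (\<lambda>n. f (X n) + g (X n))"
    using le f(2)[of l] g(2)[of l] by (intro ereal_liminf_add_mono) auto
  finally show "f l + g l \<le> liminf (\<lambda>n. f (X n) + g (X n))" .
qed

lemma lower_semicont_continuous:
  fixes q :: "'a::first_countable_topology \<Rightarrow> real"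
  assumes "continuous_on UNIV q"
  shows "lower_semicont (\<lambda>x. ereal (q x))"
  unfolding lower_semicont_iff_liminf
proof (intro allI impI)
  fix X and l :: 'a assume "X \<longlonglongrightarrow> l"
  then have "(\<lambda>n. q (X n)) \<longlonglongrightarrow> q l"
    using assms by (auto intro: continuous_on_tendsto_compose)
  then have "liminf (\<lambda>n. ereal (q (X n))) = ereal (q l)"
    by (intro lim_imp_Liminf) auto
  then show "ereal (q l) \<le> liminf (\<lambda>n. ereal (q (X n)))" by simp
qed

lemma norm_add_power2:
  fixes a b :: "'a::real_inner"
  shows "(norm (a + b))\<^sup>2 = (norm a)\<^sup>2 + 2 * (a \<bullet> b) + (norm b)\<^sup>2"
  unfolding power2_norm_eq_inner by (simp add: inner_add_left inner_add_right inner_commute)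

lemma norm_midpoint_power2:
  fixes a b :: "'a::real_inner"
  shows "(norm ((1/2) *\<^sub>R (a + b)))\<^sup>2 = ((norm a)\<^sup>2 + (norm b)\<^sup>2) / 2 - (norm (a - b))\<^sup>2 / 4"
  unfolding power2_norm_eq_inner
  by (simp add: inner_add_left inner_add_right inner_diff_left inner_diff_right inner_commute field_simps)

lemma econvex_midpoint:
  assumes "econvex F" "F x = ereal a" "F y = ereal b"
  shows "F ((1/2) *\<^sub>R (x + y)) \<le> ereal ((a + b) / 2)"
  using econvexD_real[OF assms, of "1/2"] by (simp add: scaleR_add_right add_divide_distrib)

context orthogonal_projection
begin

text \<open>The first term is \<open>N / 2\<close> times the squared distance to the range of
  \<open>Pr\<close>, the second a proximal term. Large \<open>N\<close> approximates the constraint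
  \<open>Pr x = x\<close>, whereas \<open>N = 0\<close> gives the proximal map.\<close>

definition penalty :: "real \<Rightarrow> real \<Rightarrow> 'h \<Rightarrow> 'h \<Rightarrow> real" where
  "penalty N \<kappa> x0 x = N / 2 * (norm (x - Pr x))\<^sup>2 + \<kappa> / 2 * (norm (x - x0))\<^sup>2"

text \<open>An exact second-order expansion, in which the vector paired with \<open>h\<close> is the
  gradient. It takes this form because \<open>x - Pr x\<close> lies in the kernel of
  \<open>Pr\<close>.\<close>

lemma penalty_add:
  "penalty N \<kappa> x0 (x + h) = penalty N \<kappa> x0 x + (N *\<^sub>R (x - Pr x) + \<kappa> *\<^sub>R (x - x0)) \<bullet> h
     + (N / 2 * (norm (h - Pr h))\<^sup>2 + \<kappa> / 2 * (norm h)\<^sup>2)"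
proof -
  have "x + h - Pr (x + h) = (x - Pr x) + (h - Pr h)" by (simp add: add)
  then have 1: "(norm (x + h - Pr (x + h)))\<^sup>2
      = (norm (x - Pr x))\<^sup>2 + 2 * ((x - Pr x) \<bullet> (h - Pr h)) + (norm (h - Pr h))\<^sup>2"
    by (simp only: norm_add_power2)
  have "x + h - x0 = (x - x0) + h" by simp
  then have 2: "(norm (x + h - x0))\<^sup>2 = (norm (x - x0))\<^sup>2 + 2 * ((x - x0) \<bullet> h) + (norm h)\<^sup>2"
    by (simp only: norm_add_power2)
  have "Pr (x - Pr x) = 0" by (simp add: diff idem)
  then have 3: "(x - Pr x) \<bullet> (h - Pr h) = (x - Pr x) \<bullet> h"
    using selfadjoint[of "x - Pr x" h] by (simp add: inner_diff_right)
  show ?thesis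
    unfolding penalty_def 1 2 3 by (simp add: inner_add_left algebra_simps)
qed

lemma penalty_midpoint:
  assumes "0 \<le> N"
  shows "penalty N \<kappa> x0 ((1/2) *\<^sub>R (x + y))
    \<le> (penalty N \<kappa> x0 x + penalty N \<kappa> x0 y) / 2 - \<kappa> / 8 * (norm (x - y))\<^sup>2"
proof -
  have eq: "(1/2) *\<^sub>R (x + y) - Pr ((1/2) *\<^sub>R (x + y)) = (1/2) *\<^sub>R ((x - Pr x) + (y - Pr y))"
    "(1/2) *\<^sub>R (x + y) - x0 = (1/2) *\<^sub>R ((x - x0) + (y - x0))"
    by (simp_all add: add scale algebra_simps flip: scaleR_add_left)
  have "0 \<le> N * (norm ((x - Pr x) - (y - Pr y)))\<^sup>2" using assms by simp
  then show ?thesis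
    unfolding penalty_def eq norm_midpoint_power2 by (simp add: field_simps)
qed

lemma continuous_penalty: "continuous_on UNIV (penalty N \<kappa> x0)"
  unfolding penalty_def
  by (intro continuous_intros bounded_linear.continuous_on[OF bounded_linear])

lemma penalized_minimizer:
  assumes F: "F \<in> Gamma_class" and \<kappa>: "\<kappa> > 0" and N: "N \<ge> 0"
  shows "\<exists>x. - (N *\<^sub>R (x - Pr x) + \<kappa> *\<^sub>R (x - x0)) \<in> subdiff F x"
proof -
  have P: "proper_fun F" and C: "econvex F" and L: "lower_semicont F"
    using F by (auto simp: Gamma_class_def)
  define q where "q = penalty N \<kappa> x0"
  define G where "G = (\<lambda>x. F x + ereal (q x))"
  obtain A B where B: "B \<ge> 0" and AB: "\<And>x. ereal (A - B * norm x) \<le> F x"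
    using Gamma_class_linear_minorant[OF F] by metis
  have "\<exists>x. \<forall>y. G x \<le> G y"
  proof (rule uniformly_convex_has_minimizer)
    show "lower_semicont G"
      unfolding G_def q_def using P
      by (intro lower_semicont_add L lower_semicont_continuous continuous_penalty)
        (auto simp: proper_fun_def)
    fix x
    define u where "u = norm (x - x0)"
    have "norm x \<le> norm x0 + u" unfolding u_def using norm_triangle_sub[of x x0] by simp
    then have "B * norm x \<le> B * (norm x0 + u)" using B by (intro mult_left_mono)
    \<comment> \<open>Completing the square: the quadratic term outweighs the linear decrease
      allowed by the minorant.\<close>
    moreover have "\<kappa> / 2 * u\<^sup>2 - B * u + B\<^sup>2 / (2 * \<kappa>) = \<kappa> / 2 * (u - B / \<kappa>)\<^sup>2"
      using \<kappa> by (simp add: power2_eq_square field_simps)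
    moreover have "0 \<le> \<kappa> / 2 * (u - B / \<kappa>)\<^sup>2" using \<kappa> by simp
    moreover have "\<kappa> / 2 * u\<^sup>2 \<le> q x" using N by (simp add: q_def penalty_def u_def)
    ultimately have "A - B * norm x0 - B\<^sup>2 / (2 * \<kappa>) \<le> (A - B * norm x) + q x"
      by (simp add: algebra_simps)
    then have "ereal (A - B * norm x0 - B\<^sup>2 / (2 * \<kappa>)) \<le> ereal (A - B * norm x) + ereal (q x)" by simp
    also have "\<dots> \<le> G x" unfolding G_def using AB by (intro add_right_mono)
    finally show "ereal (A - B * norm x0 - B\<^sup>2 / (2 * \<kappa>)) \<le> G x" .
  next
    obtain x where "F x \<noteq> \<infinity>" using P by (auto simp: proper_fun_def)
    then show "\<exists>x. G x < \<infinity>" by (intro exI[of _ x]) (auto simp: G_def)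
  next
    show "\<kappa> / 8 > 0" using \<kappa> by simp
    fix x y r assume r: "G x \<le> ereal r" "G y \<le> ereal r"
    have "F x \<noteq> \<infinity>" "F y \<noteq> \<infinity>" using r by (auto simp: G_def)
    then obtain a b where a: "F x = ereal a" and b: "F y = ereal b"
      using proper_fun_real[OF P] by metis
    have "G ((1/2) *\<^sub>R (x + y)) \<le> ereal ((a + b) / 2) + ereal (q ((1/2) *\<^sub>R (x + y)))"
      unfolding G_def by (intro add_right_mono econvex_midpoint[OF C a b])
    also have "\<dots> \<le> ereal ((a + b) / 2 + ((q x + q y) / 2 - \<kappa> / 8 * (norm (x - y))\<^sup>2))"
      unfolding q_def using penalty_midpoint[OF N] by simp
    also have "\<dots> \<le> ereal (r - \<kappa> / 8 * (norm (x - y))\<^sup>2)"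
      using r by (simp add: G_def a b field_simps)
    finally show "G ((1/2) *\<^sub>R (x + y)) \<le> ereal (r - \<kappa> / 8 * (norm (x - y))\<^sup>2)" .
  qed
  then obtain x where x: "\<And>z. F x + ereal (q x) \<le> F z + ereal (q z)"
    unfolding G_def by blast
  have "q (x + h) \<le> q x + (N *\<^sub>R (x - Pr x) + \<kappa> *\<^sub>R (x - x0)) \<bullet> h + (N / 2 + \<kappa> / 2) * (norm h)\<^sup>2" for h
  proof -
    have "N / 2 * (norm (h - Pr h))\<^sup>2 \<le> N / 2 * (norm h)\<^sup>2"
      using N norm_diff_le by (intro mult_left_mono power_mono) auto
    then show ?thesis unfolding q_def penalty_add distrib_right by linarith
  qed
  then show ?thesis using smooth_minimizer_subgradient[OF P C x] by blast
qed

end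

section \<open>Existence of asymptotic centers\<close>

text \<open>That is, \<open>c\<close> minimises \<open>limsup (norm (w n - c))\<^sup>2\<close>, and the minimum is \<open>\<rho>\<close>; asking for quadratic growth
  at \<open>c\<close> makes the center unique.\<close>

definition asymptotic_center :: "(nat \<Rightarrow> 'a::real_inner) \<Rightarrow> 'a \<Rightarrow> real \<Rightarrow> bool" where
  "asymptotic_center w c \<rho> \<longleftrightarrow>
     (\<forall>r>\<rho>. \<forall>\<^sub>F n in sequentially. (norm (w n - c))\<^sup>2 < r) \<and>
     (\<forall>c' r. (\<forall>\<^sub>F n in sequentially. (norm (w n - c'))\<^sup>2 \<le> r) \<longrightarrow> \<rho> + (norm (c' - c))\<^sup>2 / 2 \<le> r)"

text \<open>The limsup of the squared distances inherits a midpoint inequality from the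
  parallelogram identity, so it is uniformly convex in the candidate center and has a minimiser by
  completeness.\<close>

lemma asymptotic_center_exists:
  fixes w :: "nat \<Rightarrow> 'a::{real_inner, complete_space}"
  assumes bdd: "\<And>n. norm (w n) \<le> K"
  shows "\<exists>c \<rho>. asymptotic_center w c \<rho>"
proof -
  define G where "G = (\<lambda>c. limsup (\<lambda>n. ereal ((norm (w n - c))\<^sup>2)))"
  have le_iff: "G c \<le> ereal r \<longleftrightarrow> (\<forall>r'>r. \<forall>\<^sub>F n in sequentially. (norm (w n - c))\<^sup>2 < r')" for c r
  proof
    assume "G c \<le> ereal r"
    then show "\<forall>r'>r. \<forall>\<^sub>F n in sequentially. (norm (w n - c))\<^sup>2 < r'"
      unfolding G_def Limsup_le_iff by (auto dest: spec[of _ "ereal _"])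
  next
    assume *: "\<forall>r'>r. \<forall>\<^sub>F n in sequentially. (norm (w n - c))\<^sup>2 < r'"
    show "G c \<le> ereal r" unfolding G_def Limsup_le_iff
    proof (intro allI impI)
      fix y assume "ereal r < y"
      then show "\<forall>\<^sub>F n in sequentially. ereal ((norm (w n - c))\<^sup>2) < y"
        using * by (cases y) auto
    qed
  qed
  have leI: "G c \<le> ereal r" if "\<forall>\<^sub>F n in sequentially. (norm (w n - c))\<^sup>2 \<le> r" for c r
    unfolding G_def using that by (intro Limsup_bounded) auto
  have nonneg: "0 \<le> G c" for c
    unfolding G_def by (intro le_Limsup) (auto simp: sequentially_bot)
  have fin: "G c < \<infinity>" for c
  proof -
    have "(norm (w n - c))\<^sup>2 \<le> (K + norm c)\<^sup>2" for n
      using norm_triangle_ineq4[of "w n" c] bdd[of n] by (intro power_mono) auto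
    then have "G c \<le> ereal ((K + norm c)\<^sup>2)" by (intro leI) simp
    then show ?thesis by auto
  qed
  have mid: "G ((1/2) *\<^sub>R (a + b)) \<le> ereal ((r + s) / 2 - (norm (a - b))\<^sup>2 / 4)"
    if "G a \<le> ereal r" "G b \<le> ereal s" for a b r s
    unfolding le_iff
  proof (intro allI impI)
    fix r' assume r': "(r + s) / 2 - (norm (a - b))\<^sup>2 / 4 < r'"
    define e where "e = r' - ((r + s) / 2 - (norm (a - b))\<^sup>2 / 4)"
    have "e > 0" using r' by (simp add: e_def)
    then have "\<forall>\<^sub>F n in sequentially. (norm (w n - a))\<^sup>2 < r + e"
      "\<forall>\<^sub>F n in sequentially. (norm (w n - b))\<^sup>2 < s + e"
      using that unfolding le_iff by auto
    then show "\<forall>\<^sub>F n in sequentially. (norm (w n - (1/2) *\<^sub>R (a + b)))\<^sup>2 < r'"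
    proof eventually_elim
      case (elim n)
      have "w n - (1/2) *\<^sub>R (a + b) = (1/2) *\<^sub>R ((w n - a) + (w n - b))"
        by (simp add: algebra_simps flip: scaleR_add_left)
      then have "(norm (w n - (1/2) *\<^sub>R (a + b)))\<^sup>2
          = ((norm (w n - a))\<^sup>2 + (norm (w n - b))\<^sup>2) / 2 - (norm (a - b))\<^sup>2 / 4"
        by (simp only: norm_midpoint_power2) (simp add: norm_minus_commute)
      then show ?case using elim by (simp add: e_def field_simps)
    qed
  qed
  have "\<exists>c. \<forall>c'. G c \<le> G c'"
  proof (rule uniformly_convex_has_minimizer)
    show "lower_semicont G"
      unfolding lower_semicont_iff_liminf
    proof (intro allI impI)
      fix X and l :: 'a assume X: "X \<longlonglongrightarrow> l"
      show "G l \<le> liminf (\<lambda>n. G (X n))"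
        unfolding le_Liminf_iff
      proof (intro allI impI, rule ccontr)
        fix y assume y: "y < G l" and "\<not> (\<forall>\<^sub>F n in sequentially. y < G (X n))"
        then have fr: "\<exists>\<^sub>F n in sequentially. G (X n) \<le> y"
          by (simp add: not_eventually not_less)
        then obtain n0 where "G (X n0) \<le> y" using frequently_ex by blast
        with nonneg[of "X n0"] have "0 \<le> y" by (rule order_trans)
        then obtain y' where y': "y = ereal y'" "y' \<ge> 0" using y fin[of l] by (cases y) auto
        obtain r where r: "y' < r" "ereal r < G l"
          using ereal_dense2[OF y] unfolding y' by auto
        \<comment> \<open>The level midway between \<open>y'\<close> and \<open>r\<close> absorbs
          the strictness of the limsup bound; moving from \<open>X n\<close> to \<open>l\<close>
          keeps the squared distance below \<open>r\<close> once \<open>X n\<close> is close to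
          \<open>l\<close>.\<close>
        have "((\<lambda>n. (sqrt ((y' + r) / 2) + norm (X n - l))\<^sup>2)
            \<longlongrightarrow> (sqrt ((y' + r) / 2) + norm (l - l))\<^sup>2) sequentially"
          by (intro tendsto_intros X)
        moreover have "(sqrt ((y' + r) / 2) + norm (l - l))\<^sup>2 < r"
          using y' r by simp
        ultimately have "\<forall>\<^sub>F n in sequentially. (sqrt ((y' + r) / 2) + norm (X n - l))\<^sup>2 < r"
          by (rule order_tendstoD)
        with fr obtain n where n: "G (X n) \<le> y" "(sqrt ((y' + r) / 2) + norm (X n - l))\<^sup>2 < r"
          by (blast dest: frequently_eventually_frequently frequently_ex)
        have "\<forall>\<^sub>F k in sequentially. (norm (w k - X n))\<^sup>2 < (y' + r) / 2"
          using n(1) r(1) unfolding y' le_iff by (auto dest!: spec[of _ "(y' + r) / 2"])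
        then have "\<forall>\<^sub>F k in sequentially. (norm (w k - l))\<^sup>2 \<le> r"
        proof eventually_elim
          case (elim k)
          have "norm (w k - X n) \<le> sqrt ((y' + r) / 2)" using elim by (intro real_le_rsqrt) simp
          moreover have "norm (w k - l) \<le> norm (w k - X n) + norm (X n - l)"
            using norm_triangle_ineq[of "w k - X n" "X n - l"] by simp
          ultimately have "(norm (w k - l))\<^sup>2 \<le> (sqrt ((y' + r) / 2) + norm (X n - l))\<^sup>2"
            by (intro power_mono) auto
          then show ?case using n(2) by simp
        qed
        then have "G l \<le> ereal r" by (rule leI)
        then show False using r(2) by simp
      qed
    qed
    show "ereal 0 \<le> G c" for c using nonneg by (simp add: zero_ereal_def)
    show "\<exists>c. G c < \<infinity>" using fin by blast
    show "1 / 4 > (0::real)" by simp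
    show "G ((1/2) *\<^sub>R (a + b)) \<le> ereal (r - 1 / 4 * (norm (a - b))\<^sup>2)"
      if "G a \<le> ereal r" "G b \<le> ereal r" for a b r
      using mid[OF that] by simp
  qed
  then obtain c where c: "\<And>c'. G c \<le> G c'" by blast
  obtain \<rho> where \<rho>: "G c = ereal \<rho>" using fin[of c] nonneg[of c] by (cases "G c") auto
  show ?thesis
    unfolding asymptotic_center_def
  proof (intro exI[of _ c] exI[of _ \<rho>] conjI allI impI)
    show "\<forall>\<^sub>F n in sequentially. (norm (w n - c))\<^sup>2 < r" if "\<rho> < r" for r
      using le_iff[of c \<rho>] \<rho> that by simp
    show "\<rho> + (norm (c' - c))\<^sup>2 / 2 \<le> r"
      if "\<forall>\<^sub>F n in sequentially. (norm (w n - c'))\<^sup>2 \<le> r" for c' r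
    proof -
      \<comment> \<open>The minimum is compared with the value at the midpoint of \<open>c'\<close>
        and \<open>c\<close>; solving for \<open>r\<close> yields the growth constant 1/2.\<close>
      have "ereal \<rho> \<le> ereal ((r + \<rho>) / 2 - (norm (c' - c))\<^sup>2 / 4)"
        using mid[OF leI[OF that], of c \<rho>] c \<rho> by (metis order.trans order_refl)
      then show ?thesis by (simp add: field_simps)
    qed
  qed
qed

section \<open>Asymptotic centers and weak convergence\<close>

text \<open>If \<open>c\<close> violated the bound, moving it a little against \<open>u\<close>
  would bring it closer to the \<open>w n\<close> and lower the asymptotic radius. So half-spaces
  pass to centers as they would to weak limits.\<close>

lemma asymptotic_center_inner_le:
  fixes w :: "nat \<Rightarrow> 'a::real_inner"
  assumes c: "asymptotic_center w c \<rho>"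
    and b: "\<And>e. e > 0 \<Longrightarrow> \<forall>\<^sub>F n in sequentially. w n \<bullet> u \<le> b + e"
  shows "c \<bullet> u \<le> b"
proof (rule ccontr)
  assume "\<not> c \<bullet> u \<le> b"
  then have g: "c \<bullet> u - b > 0" (is "?g > 0") by simp
  show False
  proof (cases "u = 0")
    case True
    then have "\<forall>\<^sub>F n in sequentially. 0 \<le> b - b / 2"
      using b[of "- b / 2"] g by simp
    then show False using True g by simp
  next
    case False
    \<comment> \<open>With this step length the quadratic cost is \<open>t * ?g / 2\<close>, the
      slack in the radius another \<open>t * ?g / 2\<close>, and the gain from the half-space at
      least three halves of \<open>t * ?g\<close>.\<close>
    define t where "t = ?g / (2 * (norm u)\<^sup>2)"
    have t: "t > 0" using g False by (simp add: t_def)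
    have tg: "t\<^sup>2 * (norm u)\<^sup>2 = t * ?g / 2" using False by (simp add: t_def power2_eq_square)
    have "\<forall>\<^sub>F n in sequentially. (norm (w n - c))\<^sup>2 < \<rho> + t * ?g / 2"
      using c t g by (simp add: asymptotic_center_def)
    moreover have "\<forall>\<^sub>F n in sequentially. w n \<bullet> u \<le> b + ?g / 4"
      using b[of "?g / 4"] g by simp
    ultimately have "\<forall>\<^sub>F n in sequentially. (norm (w n - (c - t *\<^sub>R u)))\<^sup>2 \<le> \<rho> - t * ?g / 2"
    proof eventually_elim
      case (elim n)
      have "w n - (c - t *\<^sub>R u) = (w n - c) + t *\<^sub>R u" by simp
      then have "(norm (w n - (c - t *\<^sub>R u)))\<^sup>2 = (norm (w n - c))\<^sup>2 + 2 * t * (w n \<bullet> u - c \<bullet> u) + t * ?g / 2"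
        by (simp only: norm_add_power2) (simp add: tg[symmetric] inner_diff_left power_mult_distrib)
      moreover have "2 * t * (w n \<bullet> u - c \<bullet> u) \<le> 2 * t * (- (3 / 4) * ?g)"
        using elim(2) t by (intro mult_left_mono) (simp_all add: field_simps)
      moreover have "2 * t * (- (3 / 4) * ?g) = - (3/2) * (t * ?g)" by simp
      ultimately show ?case using elim(1) by linarith
    qed
    then have "\<rho> + (norm ((c - t *\<^sub>R u) - c))\<^sup>2 / 2 \<le> \<rho> - t * ?g / 2"
      using c unfolding asymptotic_center_def by blast
    moreover have "0 < t * ?g" using t g by simp
    moreover have "0 \<le> (norm ((c - t *\<^sub>R u) - c))\<^sup>2" by simp
    ultimately show False by linarith
  qed
qed

text \<open>Asymptotic regularity and nonexpansiveness make \<open>R c\<close> asymptotically no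
  farther from the sequence than \<open>c\<close>, and quadratic growth admits only one such point.
  This takes the place of demiclosedness.\<close>

lemma asymptotic_center_fixed_point:
  fixes w :: "nat \<Rightarrow> 'a::real_inner"
  assumes c: "asymptotic_center w c \<rho>" and bdd: "\<And>n. norm (w n) \<le> K"
    and nonexp: "\<And>x y. norm (R x - R y) \<le> norm (x - y)"
    and reg: "(\<lambda>n. R (w n) - w n) \<longlonglongrightarrow> 0"
  shows "R c = c"
proof -
  define \<epsilon> where "\<epsilon> = (\<lambda>n. norm (R (w n) - w n))"
  have \<epsilon>: "\<epsilon> \<longlonglongrightarrow> 0" unfolding \<epsilon>_def using reg by (rule tendsto_norm_zero)
  have "\<rho> + (norm (R c - c))\<^sup>2 / 2 \<le> \<rho> + e" if e: "e > 0" for e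
  proof -
    have "(\<lambda>n. \<epsilon> n * (2 * (K + norm c) + \<epsilon> n)) \<longlonglongrightarrow> 0 * (2 * (K + norm c) + 0)"
      by (intro tendsto_intros \<epsilon>)
    then have "\<forall>\<^sub>F n in sequentially. \<epsilon> n * (2 * (K + norm c) + \<epsilon> n) < e / 2"
      using e by (intro order_tendstoD(2)) auto
    moreover have "\<forall>\<^sub>F n in sequentially. (norm (w n - c))\<^sup>2 < \<rho> + e / 2"
      using c e by (simp add: asymptotic_center_def)
    ultimately have "\<forall>\<^sub>F n in sequentially. (norm (w n - R c))\<^sup>2 \<le> \<rho> + e"
    proof eventually_elim
      case (elim n)
      have "norm (w n - R c) \<le> norm (w n - R (w n)) + norm (R (w n) - R c)"
        using norm_triangle_ineq[of "w n - R (w n)" "R (w n) - R c"] by simp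
      also have "\<dots> \<le> \<epsilon> n + norm (w n - c)"
        using nonexp[of "w n" c] by (simp add: \<epsilon>_def norm_minus_commute)
      finally have "(norm (w n - R c))\<^sup>2 \<le> (\<epsilon> n + norm (w n - c))\<^sup>2"
        by (intro power_mono) auto
      also have "\<dots> = (norm (w n - c))\<^sup>2 + \<epsilon> n * (2 * norm (w n - c) + \<epsilon> n)"
        by (simp add: power2_eq_square algebra_simps)
      also have "\<epsilon> n * (2 * norm (w n - c) + \<epsilon> n) \<le> \<epsilon> n * (2 * (K + norm c) + \<epsilon> n)"
        using norm_triangle_ineq4[of "w n" c] bdd[of n] by (intro mult_left_mono) (auto simp: \<epsilon>_def)
      finally show ?case using elim by linarith
    qed
    then show ?thesis using c unfolding asymptotic_center_def by blast
  qed
  then have "(norm (R c - c))\<^sup>2 / 2 \<le> e" if "e > 0" for e using that by fastforce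
  then have "(norm (R c - c))\<^sup>2 / 2 \<le> 0" by (rule dense_ge)
  then show ?thesis by simp
qed

lemma asymptotic_center_le_limit:
  assumes c: "asymptotic_center w c \<rho>" and L: "(\<lambda>n. norm (w n - y)) \<longlonglongrightarrow> L"
  shows "\<rho> + (norm (y - c))\<^sup>2 / 2 \<le> L\<^sup>2"
proof (rule field_le_epsilon)
  fix e :: real assume "e > 0"
  moreover have "(\<lambda>n. (norm (w n - y))\<^sup>2) \<longlonglongrightarrow> L\<^sup>2" by (intro tendsto_intros L)
  ultimately have "\<forall>\<^sub>F n in sequentially. (norm (w n - y))\<^sup>2 < L\<^sup>2 + e"
    by (intro order_tendstoD(2)) auto
  then have "\<forall>\<^sub>F n in sequentially. (norm (w n - y))\<^sup>2 \<le> L\<^sup>2 + e"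
    by (rule eventually_mono) simp
  then show "\<rho> + (norm (y - c))\<^sup>2 / 2 \<le> L\<^sup>2 + e"
    using c unfolding asymptotic_center_def by blast
qed

lemma asymptotic_center_limit:
  assumes c: "asymptotic_center w c \<rho>" and L: "(\<lambda>n. norm (w n - c)) \<longlonglongrightarrow> L"
  shows "L\<^sup>2 = \<rho>"
proof (rule antisym)
  have "(\<lambda>n. (norm (w n - c))\<^sup>2) \<longlonglongrightarrow> L\<^sup>2" by (intro tendsto_intros L)
  moreover have "\<forall>\<^sub>F n in sequentially. (norm (w n - c))\<^sup>2 \<le> r" if "\<rho> < r" for r
  proof -
    have "\<forall>\<^sub>F n in sequentially. (norm (w n - c))\<^sup>2 < r"
      using c that by (simp add: asymptotic_center_def)
    then show ?thesis by (rule eventually_mono) simp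
  qed
  ultimately have "L\<^sup>2 \<le> r" if "\<rho> < r" for r
    using tendsto_upperbound that trivial_limit_sequentially by blast
  then show "L\<^sup>2 \<le> \<rho>" by (rule dense_ge)
  show "\<rho> \<le> L\<^sup>2" using asymptotic_center_le_limit[OF c L] by simp
qed

text \<open>A form of Opial's lemma. If the sequence failed to converge weakly to its center
  \<open>c\<close>, a subsequence would stay in a half-space excluding \<open>c\<close>. The center
  \<open>c'\<close> of that subsequence is also a fixed point, and comparing distances shows that it
  equals \<open>c\<close>, a contradiction.\<close>

lemma asymptotically_regular_weakly_converges:
  fixes s :: "nat \<Rightarrow> 'a::{real_inner, complete_space}"
  assumes nonexp: "\<And>x y. norm (R x - R y) \<le> norm (x - y)"
    and reg: "(\<lambda>n. R (s n) - s n) \<longlonglongrightarrow> 0"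
    and fixpt: "\<exists>q. R q = q"
    and conv: "\<And>y. R y = y \<Longrightarrow> convergent (\<lambda>n. norm (s n - y))"
  shows "\<exists>c. R c = c \<and> weakly_converges s c"
proof -
  obtain q where "R q = q" using fixpt by blast
  then have "Bseq (\<lambda>n. norm (s n - q))" using conv by (intro convergent_imp_Bseq)
  then obtain K0 where K0: "\<And>n. norm (s n - q) \<le> K0" by (auto simp: Bseq_def)
  have K: "norm (s n) \<le> K0 + norm q" for n
    using norm_triangle_sub[of "s n" q] K0[of n] by simp
  obtain c \<rho> where c: "asymptotic_center s c \<rho>" using asymptotic_center_exists[of s] K by blast
  have Rc: "R c = c" by (rule asymptotic_center_fixed_point[OF c K nonexp reg])
  have False if fr: "\<exists>\<^sub>F n in sequentially. s n \<bullet> v \<le> c \<bullet> v - e" and e: "e > 0" for v e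
  proof -
    have "infinite {n. s n \<bullet> v \<le> c \<bullet> v - e}"
      using fr by (simp add: frequently_cofinite flip: cofinite_eq_sequentially)
    then obtain r :: "nat \<Rightarrow> nat" where r: "strict_mono r" "\<And>n. s (r n) \<bullet> v \<le> c \<bullet> v - e"
      using infinite_enumerate by blast
    have sub: "filterlim r sequentially sequentially" using r(1) by (rule filterlim_subseq)
    obtain c' \<rho>' where c': "asymptotic_center (\<lambda>n. s (r n)) c' \<rho>'"
      using asymptotic_center_exists[of "\<lambda>n. s (r n)"] K by blast
    have Rc': "R c' = c'"
      using asymptotic_center_fixed_point[OF c' K nonexp filterlim_compose[OF reg sub]] .
    obtain L L' where L: "(\<lambda>n. norm (s n - c)) \<longlonglongrightarrow> L" and L': "(\<lambda>n. norm (s n - c')) \<longlonglongrightarrow> L'"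
      using conv[OF Rc] conv[OF Rc'] unfolding convergent_def by blast
    have rL: "(\<lambda>n. norm (s (r n) - c)) \<longlonglongrightarrow> L" "(\<lambda>n. norm (s (r n) - c')) \<longlonglongrightarrow> L'"
      using L L' sub by (auto intro: filterlim_compose[of _ _ _ r])
    \<comment> \<open>The limits \<open>L\<close> and \<open>L'\<close> are the same along the
      subsequence, so growth around \<open>c\<close> and growth around \<open>c'\<close> compare the
      same two numbers in opposite directions.\<close>
    have "L\<^sup>2 + (norm (c' - c))\<^sup>2 / 2 \<le> L'\<^sup>2"
      using asymptotic_center_le_limit[OF c L'] asymptotic_center_limit[OF c L] by simp
    moreover have "L'\<^sup>2 + (norm (c - c'))\<^sup>2 / 2 \<le> L\<^sup>2"
      using asymptotic_center_le_limit[OF c' rL(1)] asymptotic_center_limit[OF c' rL(2)] by simp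
    ultimately have "(norm (c' - c))\<^sup>2 \<le> 0" unfolding norm_minus_commute[of c c'] by linarith
    then have "c' = c" by simp
    have "s (r n) \<bullet> v \<le> (c \<bullet> v - e) + e'" if "e' > 0" for e' n
      using r(2)[of n] that by simp
    then have "c' \<bullet> v \<le> c \<bullet> v - e"
      by (intro asymptotic_center_inner_le[OF c'] always_eventually) auto
    then show False using e \<open>c' = c\<close> by simp
  qed
  note not_fr = this
  have "weakly_converges s c"
    unfolding weakly_converges_def tendsto_iff
  proof (intro allI impI)
    fix u and e :: real assume e: "e > 0"
    have "\<forall>\<^sub>F n in sequentially. \<not> s n \<bullet> u \<le> c \<bullet> u - e"
      "\<forall>\<^sub>F n in sequentially. \<not> s n \<bullet> (- u) \<le> c \<bullet> (- u) - e"
      using not_fr[OF _ e] not_frequently by metis+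
    then show "\<forall>\<^sub>F n in sequentially. dist (s n \<bullet> u) (c \<bullet> u) < e"
      by eventually_elim (auto simp: dist_real_def)
  qed
  with Rc show ?thesis by blast
qed

section \<open>Uniform boundedness on a closed subspace\<close>

text \<open>The gliding hump: \<open>v (Suc n)\<close> moves a distance \<open>3\<^sup>-\<^sup>n\<close> from \<open>v n\<close> along the direction of
  a functional of norm at least \<open>4\<^sup>n\<close>, which the later steps cannot undo.\<close>

lemma uniform_boundedness_subspace:
  fixes y :: "nat \<Rightarrow> 'a::{real_inner, complete_space}"
  assumes V: "subspace V" "closed V" and yV: "\<And>k. y k \<in> V"
    and bdd: "\<And>v. v \<in> V \<Longrightarrow> \<exists>C. \<forall>k. y k \<bullet> v \<le> C"
  shows "\<exists>K. \<forall>k. norm (y k) \<le> K"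
proof (rule ccontr)
  assume "\<not> ?thesis"
  then have "\<forall>n. \<exists>k. 4 ^ n < norm (y k)" by (meson not_le)
  then obtain \<kappa> where \<kappa>: "\<And>n::nat. 4 ^ n < norm (y (\<kappa> n))" by metis
  define Y where "Y = (\<lambda>n. y (\<kappa> n))"
  have Ypos: "norm (Y n) > 0" for n using \<kappa>[of n] unfolding Y_def by (smt (verit) zero_less_power)
  \<comment> \<open>The sign is chosen so that the increment, of norm \<open>(1/3) ^ n\<close>, adds
    \<open>(1/3) ^ n * norm (Y n)\<close> to the absolute value of
    \<open>Y n \<bullet> v\<close>.\<close>
  define step where "step = (\<lambda>n v. v + ((if 0 \<le> Y n \<bullet> v then 1 else -1) * (1/3) ^ n / norm (Y n)) *\<^sub>R Y n)"
  define v where "v = rec_nat 0 step"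
  have v0: "v 0 = 0" and vS: "v (Suc n) = step n (v n)" for n by (simp_all add: v_def)
  have vV: "v n \<in> V" for n
    by (induction n) (auto simp: v0 vS step_def Y_def intro!: subspace_0 subspace_add subspace_diff subspace_scale V yV)
  have dv: "norm (v (Suc n) - v n) = (1/3) ^ n" for n
    using Ypos[of n] by (simp add: vS step_def abs_mult)
  have tail: "norm (v m - v n) \<le> 3 / 2 * ((1/3) ^ n - (1/3) ^ m)" if "n \<le> m" for n m
    using that
  proof (induction m rule: dec_induct)
    case base then show ?case by simp
  next
    case (step m)
    have "norm (v (Suc m) - v n) \<le> norm (v (Suc m) - v m) + norm (v m - v n)"
      using norm_triangle_ineq[of "v (Suc m) - v m" "v m - v n"] by simp
    then show ?case using step.IH dv[of m] by simp
  qed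
  have tail': "norm (v m - v n) \<le> 3 / 2 * (1/3) ^ n" if "n \<le> m" for n m
    using tail[OF that] by (rule order_trans) simp
  have "Cauchy v"
  proof (rule metric_CauchyI)
    fix e :: real assume "e > 0"
    obtain N where N: "(1/3::real) ^ N < e / 3"
      using real_arch_pow_inv[of "e/3" "1/3"] \<open>e > 0\<close> by auto
    have "dist (v m) (v n) < e" if "N \<le> m" "N \<le> n" for m n
    proof -
      have "dist (v m) (v n) \<le> norm (v m - v N) + norm (v n - v N)"
        using norm_triangle_ineq4[of "v m - v N" "v n - v N"] by (simp add: dist_norm)
      then show ?thesis using tail'[OF that(1)] tail'[OF that(2)] N by simp
    qed
    then show "\<exists>M. \<forall>m\<ge>M. \<forall>n\<ge>M. dist (v m) (v n) < e" by blast
  qed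
  then obtain l where l: "v \<longlonglongrightarrow> l" using Cauchy_convergent_iff convergent_def by blast
  have lV: "l \<in> V" using closed_sequentially[OF V(2)] vV l by blast
  have big: "(4/3) ^ n / 2 \<le> \<bar>Y n \<bullet> l\<bar>" for n
  proof -
    have "Y n \<bullet> v (Suc n) = Y n \<bullet> v n + (if 0 \<le> Y n \<bullet> v n then 1 else -1) * ((1/3) ^ n * norm (Y n))"
      using Ypos[of n]
      by (simp add: vS step_def inner_add_right power2_norm_eq_inner[symmetric] power2_eq_square)
    moreover have "0 \<le> (1/3) ^ n * norm (Y n)" by simp
    ultimately have 1: "(1/3) ^ n * norm (Y n) \<le> \<bar>Y n \<bullet> v (Suc n)\<bar>" by (auto split: if_splits)
    have "(\<lambda>m. norm (v m - v (Suc n))) \<longlonglongrightarrow> norm (l - v (Suc n))" by (intro tendsto_intros l)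
    \<comment> \<open>All later steps together move at most half as far as step \<open>n\<close>
      did, so half of its gain survives in the limit.\<close>
    then have "norm (l - v (Suc n)) \<le> 3 / 2 * (1/3) ^ Suc n"
      by (rule tendsto_upperbound[OF _ eventually_sequentiallyI[OF tail'] sequentially_bot])
    then have "norm (Y n) * norm (l - v (Suc n)) \<le> norm (Y n) * ((1/3) ^ n / 2)"
      by (intro mult_left_mono) auto
    moreover have "\<bar>Y n \<bullet> (l - v (Suc n))\<bar> \<le> norm (Y n) * norm (l - v (Suc n))"
      by (rule Cauchy_Schwarz_ineq2)
    moreover have "Y n \<bullet> (l - v (Suc n)) = Y n \<bullet> l - Y n \<bullet> v (Suc n)" by (rule inner_diff_right)
    ultimately have "(1/3) ^ n * norm (Y n) / 2 \<le> \<bar>Y n \<bullet> l\<bar>" using 1 by (simp add: mult.commute)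
    moreover have "(1/3) ^ n * 4 ^ n \<le> (1/3) ^ n * norm (Y n)"
      using \<kappa>[of n] by (intro mult_left_mono) (auto simp: Y_def)
    moreover have "(1/3) ^ n * 4 ^ n = (4/3::real) ^ n" by (simp flip: power_mult_distrib)
    ultimately show ?thesis by linarith
  qed
  obtain C1 where C1: "\<And>k. y k \<bullet> l \<le> C1" using bdd[OF lV] by blast
  obtain C2 where C2: "\<And>k. y k \<bullet> (- l) \<le> C2" using bdd[OF subspace_neg[OF V(1) lV]] by blast
  obtain n where n: "2 * (\<bar>C1\<bar> + \<bar>C2\<bar>) < (4/3::real) ^ n"
    using real_arch_pow[of "4/3::real" "2 * (\<bar>C1\<bar> + \<bar>C2\<bar>)"] by auto
  have "\<bar>Y n \<bullet> l\<bar> \<le> \<bar>C1\<bar> + \<bar>C2\<bar>"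
    using C1[of "\<kappa> n"] C2[of "\<kappa> n"] by (auto simp: Y_def)
  then show False using big[of n] n by simp
qed

section \<open>The sum rule\<close>

context orthogonal_projection
begin

text \<open>With \<open>D\<close> the range of \<open>Pr\<close>, the closed subspace \<open>V\<close> is the cone generated by \<open>dom F - D\<close>. The negative
  gradients \<open>Y n\<close> of the penalty terms \<open>n/2 * dist(x, D)\<^sup>2\<close> at the minimisers \<open>X n\<close> of the penalised problems
  are bounded by the uniform boundedness principle on \<open>V\<close>; their asymptotic center is the multiplier.\<close>

lemma subdiff_orthogonal_exists:
  assumes F: "F \<in> Gamma_class" and xb: "Pr xb = xb" "F xb \<noteq> \<infinity>"
    and opt: "\<And>z. Pr z = z \<Longrightarrow> F xb \<le> F z"
    and V: "subspace V" "closed V"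
    and V1: "\<And>s d. F s \<noteq> \<infinity> \<Longrightarrow> Pr d = d \<Longrightarrow> s - d \<in> V"
    and V2: "\<And>v. v \<in> V \<Longrightarrow> \<exists>c>0. \<exists>s d. F s \<noteq> \<infinity> \<and> Pr d = d \<and> v = c *\<^sub>R (s - d)"
  shows "\<exists>v. v \<in> subdiff F xb \<and> Pr v = 0"
proof -
  have P: "proper_fun F" and C: "econvex F" and L: "lower_semicont F"
    using F by (auto simp: Gamma_class_def)
  obtain a where a: "F xb = ereal a" using proper_fun_real[OF P xb(2)] by blast
  have "\<exists>x. - (real n *\<^sub>R (x - Pr x) + 1 *\<^sub>R (x - xb)) \<in> subdiff F x" for n
    by (rule penalized_minimizer[OF F]) auto
  then obtain X where X: "\<And>n. - (real n *\<^sub>R (X n - Pr (X n)) + 1 *\<^sub>R (X n - xb)) \<in> subdiff F (X n)"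
    by metis
  define Y where "Y = (\<lambda>n. - (real n *\<^sub>R (X n - Pr (X n))))"
  have "\<exists>r. F (X n) = ereal r" for n
    using X[of n] by (intro proper_fun_real[OF P]) (auto simp: subdiff_def)
  then obtain fr where fr: "\<And>n. F (X n) = ereal (fr n)" by metis
  have sub: "fr n + (Y n - (X n - xb)) \<bullet> (z - X n) \<le> b" if "F z = ereal b" for n z b
  proof -
    have "- (real n *\<^sub>R (X n - Pr (X n)) + 1 *\<^sub>R (X n - xb)) = Y n - (X n - xb)" by (simp add: Y_def)
    then have "Y n - (X n - xb) \<in> subdiff F (X n)" using X[of n] by (simp only:)
    then have "F (X n) + ereal ((Y n - (X n - xb)) \<bullet> (z - X n)) \<le> F z"
      unfolding subdiff_def by blast
    then show ?thesis by (simp add: fr that)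
  qed
  define q where "q = (\<lambda>n. penalty (real n) 1 xb)"
  \<comment> \<open>The subgradient inequality combined with the expansion of the penalty sharpens
    minimality by half the squared distance to \<open>X n\<close>.\<close>
  have min: "fr n + q n (X n) + (norm (z - X n))\<^sup>2 / 2 \<le> b + q n z" if "F z = ereal b" for n z b
  proof -
    have "q n z = q n (X n + (z - X n))" by simp
    also have "\<dots> \<ge> q n (X n) + (real n *\<^sub>R (X n - Pr (X n)) + 1 *\<^sub>R (X n - xb)) \<bullet> (z - X n) + (norm (z - X n))\<^sup>2 / 2"
      unfolding q_def penalty_add by simp
    also have "real n *\<^sub>R (X n - Pr (X n)) + 1 *\<^sub>R (X n - xb) = - (Y n - (X n - xb))" by (simp add: Y_def)
    finally show ?thesis using sub[OF that, of n] by (simp add: inner_diff_left)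
  qed
  have q_mono: "q n x \<le> q m x" if "n \<le> m" for n m x
    unfolding q_def penalty_def using that by (intro add_right_mono mult_right_mono) auto
  \<comment> \<open>These minimal values increase with \<open>n\<close>, stay below
    \<open>a\<close>, and their differences dominate half the squared distances between minimisers;
    hence \<open>X\<close> is Cauchy.\<close>
  define \<theta> where "\<theta> = (\<lambda>n. fr n + q n (X n))"
  have \<theta>_le: "\<theta> n \<le> a" for n
  proof -
    have "q n xb = 0" by (simp add: q_def penalty_def xb(1))
    then show ?thesis
      using min[OF a, of n] zero_le_power2[of "norm (xb - X n)"] unfolding \<theta>_def by linarith
  qed
  have \<theta>_diff: "\<theta> n + (norm (X m - X n))\<^sup>2 / 2 \<le> \<theta> m" if "n \<le> m" for n m
    using min[OF fr[of m], of n] q_mono[OF that, of "X m"] unfolding \<theta>_def by linarith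
  have "incseq \<theta>"
    using \<theta>_diff by (intro incseq_SucI) (smt (verit) le_SucI order_refl zero_le_power2 divide_nonneg_nonneg)
  then have "Cauchy \<theta>"
    using \<theta>_le by (metis incseq_convergent LIMSEQ_imp_Cauchy)
  have "Cauchy X"
  proof (rule metric_CauchyI)
    fix e :: real assume e: "e > 0"
    then obtain M where M: "\<And>m n. m \<ge> M \<Longrightarrow> n \<ge> M \<Longrightarrow> dist (\<theta> m) (\<theta> n) < e\<^sup>2 / 2"
      using metric_CauchyD[OF \<open>Cauchy \<theta>\<close>, of "e\<^sup>2 / 2"] by auto
    have *: "norm (X m - X n) < e" if "M \<le> n" "n \<le> m" for m n
    proof -
      have "(norm (X m - X n))\<^sup>2 < e\<^sup>2"
        using \<theta>_diff[OF that(2)] M[OF order_trans[OF that] that(1)] abs_ge_self[of "\<theta> m - \<theta> n"]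
        unfolding dist_real_def by linarith
      then show ?thesis using e by (simp add: power2_less_imp_less)
    qed
    show "\<exists>M. \<forall>m\<ge>M. \<forall>n\<ge>M. dist (X m) (X n) < e"
    proof (intro exI allI impI)
      fix m n assume "M \<le> m" "M \<le> n"
      then show "dist (X m) (X n) < e"
        using *[of n m] *[of m n] by (cases "n \<le> m") (auto simp: dist_norm norm_minus_commute)
    qed
  qed
  then obtain l where l: "X \<longlonglongrightarrow> l" using Cauchy_convergent_iff convergent_def by blast
  obtain K where K: "\<And>n. norm (X n) \<le> K"
    using convergent_imp_Bseq[of X] l by (auto simp: convergent_def Bseq_def)
  obtain A B where B: "B \<ge> 0" and AB: "\<And>x. ereal (A - B * norm x) \<le> F x"
    using Gamma_class_linear_minorant[OF F] by metis
  have fr_low: "A - B * K \<le> fr n" for n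
    using AB[of "X n"] mult_left_mono[OF K[of n] B] by (simp add: fr)
  have fr_up: "fr n + real n / 2 * (norm (X n - Pr (X n)))\<^sup>2 + 1 / 2 * (norm (X n - xb))\<^sup>2 \<le> a" for n
    using \<theta>_le[of n] by (simp add: \<theta>_def q_def penalty_def)
  \<comment> \<open>As \<open>fr\<close> is bounded below, the penalty terms are bounded, so the
    squared distance to the range of \<open>Pr\<close> is of order \<open>1 / n\<close>.\<close>
  have "Pr l = l"
  proof -
    have le: "(norm (X n - Pr (X n)))\<^sup>2 \<le> 2 * (a - (A - B * K)) * (1 / real n)" if "n > 0" for n
    proof -
      have "real n / 2 * (norm (X n - Pr (X n)))\<^sup>2 \<le> a - (A - B * K)"
        using fr_up[of n] fr_low[of n] zero_le_power2[of "norm (X n - xb)"] by linarith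
      then show ?thesis using that by (simp add: field_simps)
    qed
    have "(\<lambda>n. 2 * (a - (A - B * K)) * (1 / real n)) \<longlonglongrightarrow> 2 * (a - (A - B * K)) * 0"
      by (intro tendsto_intros lim_1_over_n)
    then have "(\<lambda>n. 2 * (a - (A - B * K)) * (1 / real n)) \<longlonglongrightarrow> 0" by simp
    moreover have "(\<lambda>n. (norm (X n - Pr (X n)))\<^sup>2) \<longlonglongrightarrow> (norm (l - Pr l))\<^sup>2"
      by (intro tendsto_intros tendsto l)
    ultimately have "(norm (l - Pr l))\<^sup>2 \<le> 0"
      by (rule tendsto_le[OF sequentially_bot _ _ eventually_sequentiallyI[of 1]])
        (rule le, simp)
    then show ?thesis by simp
  qed
  \<comment> \<open>The limit is feasible, so its value is at least \<open>a\<close>; the proximal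
    term centred at \<open>xb\<close> permits this only at \<open>xb\<close>.\<close>
  have "l = xb"
  proof -
    have "F l \<le> ereal (a - 1 / 2 * (norm (l - xb))\<^sup>2)"
    proof (rule lower_semicont_limit_le[OF L l])
      show "(\<lambda>n. ereal (a - 1 / 2 * (norm (X n - xb))\<^sup>2)) \<longlonglongrightarrow> ereal (a - 1 / 2 * (norm (l - xb))\<^sup>2)"
        by (intro tendsto_intros l)
      have "fr n \<le> a - 1 / 2 * (norm (X n - xb))\<^sup>2" for n
        using fr_up[of n] of_nat_0_le_iff[of n] mult_nonneg_nonneg[OF divide_nonneg_nonneg zero_le_power2, of "real n" 2 "norm (X n - Pr (X n))"] by linarith
      then show "\<forall>\<^sub>F n in sequentially. F (X n) \<le> ereal (a - 1 / 2 * (norm (X n - xb))\<^sup>2)"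
        by (simp add: fr)
    qed
    then have "ereal a \<le> ereal (a - 1 / 2 * (norm (l - xb))\<^sup>2)"
      using opt[OF \<open>Pr l = l\<close>] a by (metis order_trans)
    then show ?thesis by simp
  qed
  have PrY: "Pr (Y n) = 0" for n by (simp add: Y_def scale diff idem linear_neg[OF linear])
  have YD: "Y n \<bullet> d = 0" if "Pr d = d" for n d
    using inner_range_kernel[OF that PrY, of n] by (simp add: inner_commute)
  have key: "Y n \<bullet> z \<le> b - fr n + (X n - xb) \<bullet> (z - X n)" if "F z = ereal b" for n z b
  proof -
    have "Y n \<bullet> X n = Y n \<bullet> Pr (X n) + Y n \<bullet> (X n - Pr (X n))" by (simp add: inner_diff_right)
    also have "Y n \<bullet> Pr (X n) = 0" by (rule YD) (rule idem)
    also have "Y n \<bullet> (X n - Pr (X n)) = - (real n * (norm (X n - Pr (X n)))\<^sup>2)"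
      by (simp add: Y_def power2_norm_eq_inner)
    finally have "Y n \<bullet> X n \<le> 0" by simp
    then show ?thesis using sub[OF that, of n] by (simp add: inner_diff_left inner_diff_right)
  qed
  have "\<exists>K'. \<forall>n. norm (Y n) \<le> K'"
  proof (rule uniform_boundedness_subspace[OF V])
    fix n
    have "X n - Pr (X n) \<in> V" using fr[of n] by (intro V1) (simp_all add: idem)
    then show "Y n \<in> V" unfolding Y_def using V(1) by (intro subspace_neg subspace_scale)
  next
    fix v assume "v \<in> V"
    then obtain c s d where c: "c > 0" "F s \<noteq> \<infinity>" "Pr d = d" "v = c *\<^sub>R (s - d)" using V2 by blast
    obtain b where b: "F s = ereal b" using proper_fun_real[OF P c(2)] by blast
    have "Y n \<bullet> v \<le> c * (b - (A - B * K) + (K + norm xb) * (norm s + K))" for n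
    proof -
      have "(X n - xb) \<bullet> (s - X n) \<le> norm (X n - xb) * norm (s - X n)" by (rule norm_cauchy_schwarz)
      also have "\<dots> \<le> (K + norm xb) * (norm s + K)"
      proof (rule mult_mono)
        show bd: "norm (X n - xb) \<le> K + norm xb"
          using norm_triangle_ineq4[of "X n" xb] K[of n] by linarith
        show "norm (s - X n) \<le> norm s + K"
          using norm_triangle_ineq4[of s "X n"] K[of n] by linarith
        show "0 \<le> K + norm xb" using bd norm_ge_zero order_trans by blast
      qed simp
      finally have "Y n \<bullet> s \<le> b - (A - B * K) + (K + norm xb) * (norm s + K)"
        using key[OF b, of n] fr_low[of n] by linarith
      moreover have "Y n \<bullet> v = c * (Y n \<bullet> s)"
        using YD[OF c(3), of n] by (simp add: c(4) inner_diff_right)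
      ultimately show ?thesis using c(1) by (simp add: mult_left_mono)
    qed
    then show "\<exists>C. \<forall>n. Y n \<bullet> v \<le> C" by blast
  qed
  then obtain K' where K': "\<And>n. norm (Y n) \<le> K'" by blast
  obtain c \<rho> where c: "asymptotic_center Y c \<rho>" using asymptotic_center_exists[of Y] K' by blast
  \<comment> \<open>The test direction is \<open>Pr c\<close>, on which every \<open>Y n\<close>
    vanishes; the left side is the squared norm of \<open>Pr c\<close>.\<close>
  have "c \<bullet> Pr c \<le> 0"
    by (rule asymptotic_center_inner_le[OF c]) (simp add: YD idem)
  moreover have "c \<bullet> Pr c = Pr c \<bullet> Pr c" by (metis selfadjoint idem)
  ultimately have "Pr c = 0" by (metis inner_ge_zero antisym inner_eq_zero_iff)
  moreover have "ereal (a + c \<bullet> (z - xb)) \<le> F z" for z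
  proof (cases "F z = \<infinity>")
    case False
    then obtain b where b: "F z = ereal b" using proper_fun_real[OF P] by blast
    \<comment> \<open>The estimate \<open>key\<close> passes to the center as a half-space
      condition: lower semicontinuity eventually keeps \<open>fr n\<close> above
      \<open>a - e / 2\<close>, and the proximal remainder tends to 0.\<close>
    have "c \<bullet> (z - xb) \<le> b - a"
    proof (rule asymptotic_center_inner_le[OF c])
      fix e :: real assume e: "e > 0"
      have "F xb \<le> liminf (\<lambda>n. F (X n))"
        using L l \<open>l = xb\<close> unfolding lower_semicont_iff_liminf by blast
      moreover have "ereal (a - e / 2) < F xb" using e a by simp
      ultimately have "\<forall>\<^sub>F n in sequentially. ereal (a - e / 2) < F (X n)"
        unfolding le_Liminf_iff by blast
      moreover have "(\<lambda>n. (X n - xb) \<bullet> (z - X n)) \<longlonglongrightarrow> (l - xb) \<bullet> (z - l)" by (intro tendsto_intros l)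
      then have "\<forall>\<^sub>F n in sequentially. (X n - xb) \<bullet> (z - X n) < e / 2"
        using e \<open>l = xb\<close> by (intro order_tendstoD(2)) auto
      ultimately show "\<forall>\<^sub>F n in sequentially. Y n \<bullet> (z - xb) \<le> b - a + e"
      proof eventually_elim
        case (elim n)
        have "Y n \<bullet> (z - xb) = Y n \<bullet> z" using YD[OF xb(1)] by (simp add: inner_diff_right)
        then show ?case using key[OF b, of n] elim by (simp add: fr)
      qed
    qed
    then show ?thesis by (simp add: b)
  qed simp
  then have "c \<in> subdiff F xb" by (simp add: subdiff_def a)
  ultimately show ?thesis by blast
qed

end

section \<open>The inertial Krasnoselskii--Mann iteration\<close>

lemma norm_affine_combination_power2:
  fixes x y :: "'a::real_inner"
  shows "(norm ((1 - t) *\<^sub>R x + t *\<^sub>R y))\<^sup>2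
    = (1 - t) * (norm x)\<^sup>2 + t * (norm y)\<^sup>2 - t * (1 - t) * (norm (x - y))\<^sup>2"
  unfolding power2_norm_eq_inner
  by (simp add: inner_add_left inner_add_right inner_diff_left inner_diff_right inner_commute algebra_simps)

text \<open>Once the perturbation is below \<open>\<epsilon> * (1 - b)\<close>, the recursion for
  absolute values has \<open>\<epsilon>\<close> as a fixed point, and the initial excess decays like
  \<open>b ^ k\<close>.\<close>

lemma perturbed_contraction_tendsto_0:
  fixes e :: "nat \<Rightarrow> real"
  assumes b: "0 \<le> b" "b < 1" and lim: "(\<lambda>n. e (Suc n) - b * e n) \<longlonglongrightarrow> 0"
  shows "e \<longlonglongrightarrow> 0"
proof (rule LIMSEQ_I)
  fix r :: real assume r: "r > 0"
  define \<epsilon> where "\<epsilon> = r / 2"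
  have \<epsilon>: "\<epsilon> > 0" using r by (simp add: \<epsilon>_def)
  have "\<epsilon> * (1 - b) > 0" using \<epsilon> b by simp
  then obtain N where N: "\<And>n. n \<ge> N \<Longrightarrow> \<bar>e (Suc n) - b * e n\<bar> < \<epsilon> * (1 - b)"
    using LIMSEQ_D[OF lim] by fastforce
  define C where "C = \<bar>e N\<bar>"
  have bound: "\<bar>e (N + k)\<bar> \<le> \<epsilon> + b ^ k * C" for k
  proof (induction k)
    case 0 then show ?case using \<epsilon> by (simp add: C_def)
  next
    case (Suc k)
    have "\<bar>e (Suc (N + k))\<bar> \<le> \<epsilon> * (1 - b) + b * \<bar>e (N + k)\<bar>"
      using N[of "N + k"] b(1) abs_triangle_ineq[of "e (Suc (N + k)) - b * e (N + k)" "b * e (N + k)"]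
      by (simp add: abs_mult)
    also have "b * \<bar>e (N + k)\<bar> \<le> b * (\<epsilon> + b ^ k * C)" using Suc b(1) by (intro mult_left_mono)
    finally show ?case by (simp add: algebra_simps)
  qed
  have "(\<lambda>k. b ^ k * C) \<longlonglongrightarrow> 0 * C" using b by (intro tendsto_intros LIMSEQ_realpow_zero)
  then obtain k0 where k0: "\<And>k. k \<ge> k0 \<Longrightarrow> \<bar>b ^ k * C\<bar> < \<epsilon>"
    using LIMSEQ_D[of "\<lambda>k. b ^ k * C" 0 \<epsilon>] \<epsilon> by auto
  have "norm (e n - 0) < r" if "n \<ge> N + k0" for n
    using bound[of "n - N"] k0[of "n - N"] that unfolding \<epsilon>_def by (simp add: le_diff_conv2)
  then show "\<exists>no. \<forall>n\<ge>no. norm (e n - 0) < r" by blast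
qed

text \<open>Here \<open>\<mu>\<close> is the relaxation relative to the nonexpansive map, which will
  be half of the algorithm's \<open>lam\<close>. Indices are shifted so that \<open>s 0\<close>
  extrapolates from \<open>w 0\<close> and \<open>w 1\<close>.\<close>

locale inertial_km =
  fixes R :: "'h::{real_inner, complete_space} \<Rightarrow> 'h" and w s :: "nat \<Rightarrow> 'h" and a \<mu> :: "nat \<Rightarrow> real"
    and \<alpha> \<delta> \<sigma> m :: real
  assumes nonexp: "norm (R x - R y) \<le> norm (x - y)"
    and s_def: "s n = w (Suc n) + a n *\<^sub>R (w (Suc n) - w n)"
    and w_step: "w (Suc (Suc n)) = s n + \<mu> n *\<^sub>R (R (s n) - s n)"
    and a_mono: "a n \<le> a (Suc n)" and a_nonneg: "0 \<le> a n" and a_le: "a n \<le> \<alpha>" and \<alpha>: "\<alpha> < 1"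
    and \<delta>: "\<delta> > 0" and \<sigma>: "\<sigma> > 0" and m: "m > 0" and \<mu>_ge: "m \<le> \<mu> n"
    and \<mu>_le: "\<mu> n \<le> (\<delta> - \<alpha> * (\<alpha> * (1 + \<alpha>) + \<alpha> * \<delta> + \<sigma>)) / (\<delta> * (1 + \<alpha> * (1 + \<alpha>) + \<alpha> * \<delta> + \<sigma>))"
begin

definition "K = \<alpha> * (1 + \<alpha>) + \<alpha> * \<delta> + \<sigma>"
definition "D n = (norm (w (Suc n) - w n))\<^sup>2"
definition "g n = a n * (1 + a n) + a n * (1 - \<mu> n) * \<delta>"

lemma \<alpha>_nonneg: "0 \<le> \<alpha>" using a_nonneg a_le by (rule order_trans)
lemma \<mu>_pos: "0 < \<mu> n" using m \<mu>_ge by (rule less_le_trans)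
lemma K_pos: "K > 0" unfolding K_def using \<alpha>_nonneg \<delta> \<sigma> by (simp add: add_nonneg_pos)

text \<open>Regrouped, this says \<open>K * (\<alpha> + \<delta> * \<mu> n) \<le> (1 - \<mu> n) *
  \<delta>\<close>, the form in which the relaxation bound yields the energy decrease.\<close>

lemma \<mu>_K: "\<mu> n * \<delta> * (1 + K) \<le> \<delta> - \<alpha> * K"
proof -
  have "\<mu> n \<le> (\<delta> - \<alpha> * K) / (\<delta> * (1 + K))"
    using \<mu>_le[of n] by (simp add: K_def add.assoc)
  moreover have "\<delta> * (1 + K) > 0" using \<delta> K_pos by simp
  ultimately show ?thesis by (simp add: pos_le_divide_eq mult.assoc)
qed

lemma \<mu>_le_1: "\<mu> n \<le> 1"
proof -
  have "\<mu> n * \<delta> * 1 \<le> \<mu> n * \<delta> * (1 + K)"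
    using \<mu>_pos[of n] \<delta> K_pos by (intro mult_left_mono) auto
  also have "\<dots> \<le> \<delta> - \<alpha> * K" by (rule \<mu>_K)
  also have "\<dots> \<le> \<delta>" using \<alpha>_nonneg K_pos by simp
  finally show ?thesis using \<delta> by simp
qed

lemma g_nonneg: "0 \<le> g n"
  unfolding g_def using a_nonneg[of n] \<mu>_le_1[of n] \<delta> by simp

lemma g_le: "g n + \<sigma> \<le> K"
proof -
  have "a n * (1 + a n) \<le> \<alpha> * (1 + \<alpha>)"
    using a_nonneg[of n] a_le[of n] \<alpha>_nonneg by (intro mult_mono) auto
  moreover have "a n * (1 - \<mu> n) * \<delta> \<le> \<alpha> * 1 * \<delta>"
    using a_nonneg[of n] a_le[of n] \<alpha>_nonneg \<mu>_pos[of n] \<mu>_le_1[of n] \<delta>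
    by (intro mult_right_mono mult_mono) auto
  ultimately show ?thesis by (simp add: g_def K_def)
qed

definition "energy q n = (norm (w (Suc n) - q))\<^sup>2 - a n * (norm (w n - q))\<^sup>2 + g n * D n"

text \<open>Nonexpansiveness and the extrapolation identity bound the new distance, minus a multiple
  of the residual. Young's inequality converts the residual into increments, and the relaxation
  bound makes the resulting multiple of \<open>D (Suc n)\<close> at least
  \<open>g (Suc n) + \<sigma>\<close>.\<close>

lemma energy_decrease:
  assumes q: "R q = q"
  shows "energy q (Suc n) + \<sigma> * D (Suc n) \<le> energy q n"
proof -
  define \<phi> where "\<phi> = (\<lambda>n. (norm (w n - q))\<^sup>2)"
  define E where "E = (norm (R (s n) - s n))\<^sup>2"
  \<comment> \<open>The weight in Young's inequality, chosen so that the coefficients of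
    \<open>D (Suc n)\<close> and \<open>D n\<close> become
    \<open>\<delta> * \<mu> n * \<rho>\<close> and \<open>- a n * \<delta> * \<mu> n\<close>; the
    common factor \<open>\<mu> n\<close> then cancels.\<close>
  define \<rho> where "\<rho> = 1 / (a n + \<delta> * \<mu> n)"
  have den: "a n + \<delta> * \<mu> n > 0"
    using a_nonneg[of n] \<delta> \<mu>_pos[of n] by (simp add: add_nonneg_pos)
  have \<rho>: "\<rho> > 0" using den by (simp add: \<rho>_def)
  have "w (Suc (Suc n)) - q = (1 - \<mu> n) *\<^sub>R (s n - q) + \<mu> n *\<^sub>R (R (s n) - q)"
    by (simp add: w_step algebra_simps)
  then have "\<phi> (Suc (Suc n)) = (1 - \<mu> n) * (norm (s n - q))\<^sup>2 + \<mu> n * (norm (R (s n) - q))\<^sup>2 - \<mu> n * (1 - \<mu> n) * E"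
    unfolding \<phi>_def by (simp only: norm_affine_combination_power2) (simp add: E_def norm_minus_commute)
  moreover have "\<mu> n * (norm (R (s n) - q))\<^sup>2 \<le> \<mu> n * (norm (s n - q))\<^sup>2"
    using nonexp[of "s n" q] \<mu>_pos[of n] by (intro mult_left_mono power_mono) (auto simp: q)
  ultimately have 1: "\<phi> (Suc (Suc n)) \<le> (norm (s n - q))\<^sup>2 - (1 - \<mu> n) * (\<mu> n * E)"
    by (simp add: algebra_simps)
  \<comment> \<open>Extrapolation is an affine combination with the negative weight
    \<open>- a n\<close>, so the last term of the identity has a plus sign and must be absorbed by
    the energy.\<close>
  have "s n - q = (1 - (- a n)) *\<^sub>R (w (Suc n) - q) + (- a n) *\<^sub>R (w n - q)"
    by (simp add: s_def algebra_simps)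
  then have 2: "(norm (s n - q))\<^sup>2 = (1 + a n) * \<phi> (Suc n) - a n * \<phi> n + a n * (1 + a n) * D n"
    by (simp only: norm_affine_combination_power2) (simp add: \<phi>_def D_def)
  define u v where "u = w (Suc (Suc n)) - w (Suc n)" and "v = w (Suc n) - w n"
  have D_eq: "D (Suc n) = (norm u)\<^sup>2" "D n = (norm v)\<^sup>2" by (simp_all add: D_def u_def v_def)
  have "\<mu> n *\<^sub>R (R (s n) - s n) = u - a n *\<^sub>R v"
    unfolding u_def v_def w_step by (simp add: s_def algebra_simps)
  then have "(\<mu> n)\<^sup>2 * E = (norm (u - a n *\<^sub>R v))\<^sup>2"
    unfolding E_def by (metis norm_scaleR power2_abs power_mult_distrib)
  also have "\<dots> = D (Suc n) + (a n)\<^sup>2 * D n - a n * (2 * (u \<bullet> v))"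
    using norm_add_power2[of u "- (a n *\<^sub>R v)"]
    by (simp add: D_eq power_mult_distrib)
  finally have E_eq: "(\<mu> n)\<^sup>2 * E = D (Suc n) + (a n)\<^sup>2 * D n - a n * (2 * (u \<bullet> v))" .
  have uv: "2 * (u \<bullet> v) \<le> \<rho> * D (Suc n) + D n / \<rho>"
  proof -
    have "0 \<le> (norm (\<rho> *\<^sub>R u - v))\<^sup>2" by simp
    also have "\<dots> = \<rho>\<^sup>2 * D (Suc n) - 2 * \<rho> * (u \<bullet> v) + D n"
      using norm_add_power2[of "\<rho> *\<^sub>R u" "- v"]
      by (simp add: D_eq power_mult_distrib)
    finally have "\<rho> * (2 * (u \<bullet> v)) \<le> \<rho> * (\<rho> * D (Suc n) + D n / \<rho>)"
      using \<rho> by (simp add: power2_eq_square algebra_simps)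
    then show ?thesis using \<rho> by simp
  qed
  have "\<delta> * \<mu> n * \<rho> = 1 - a n * \<rho>" and "1 / \<rho> = a n + \<delta> * \<mu> n"
    using den by (simp_all add: \<rho>_def field_simps)
  note \<rho>_eq = this
  have "a n * (2 * (u \<bullet> v)) \<le> a n * (\<rho> * D (Suc n) + D n / \<rho>)"
    using uv a_nonneg by (intro mult_left_mono)
  also have "D n / \<rho> = D n * (1 / \<rho>)" by simp
  finally have "a n * (2 * (u \<bullet> v)) \<le> a n * (\<rho> * D (Suc n) + D n * (a n + \<delta> * \<mu> n))"
    by (simp only: \<rho>_eq(2))
  then have "D (Suc n) * (1 - a n * \<rho>) - a n * \<delta> * \<mu> n * D n \<le> (\<mu> n)\<^sup>2 * E"
    unfolding E_eq by (simp add: algebra_simps power2_eq_square)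
  then have "\<mu> n * (\<delta> * \<rho> * D (Suc n) - a n * \<delta> * D n) \<le> \<mu> n * (\<mu> n * E)"
    unfolding \<rho>_eq(1)[symmetric] by (simp add: algebra_simps power2_eq_square)
  then have "\<delta> * \<rho> * D (Suc n) - a n * \<delta> * D n \<le> \<mu> n * E"
    using \<mu>_pos[of n] by simp
  then have "(1 - \<mu> n) * (\<delta> * \<rho> * D (Suc n) - a n * \<delta> * D n) \<le> (1 - \<mu> n) * (\<mu> n * E)"
    using \<mu>_le_1[of n] by (intro mult_left_mono) auto
  then have 3: "\<phi> (Suc (Suc n)) \<le> (1 + a n) * \<phi> (Suc n) - a n * \<phi> n + g n * D n - (1 - \<mu> n) * \<delta> * \<rho> * D (Suc n)"
    using 1 2 by (simp add: g_def algebra_simps)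
  \<comment> \<open>The upper bound on the relaxation enters here, after multiplication by
    \<open>1 / \<rho>\<close>.\<close>
  have "(g (Suc n) + \<sigma>) * (a n + \<delta> * \<mu> n) \<le> K * (\<alpha> + \<delta> * \<mu> n)"
    using g_le[of "Suc n"] a_le[of n] den K_pos by (intro mult_mono) auto
  also have "\<dots> \<le> (1 - \<mu> n) * \<delta>" using \<mu>_K[of n] by (simp add: algebra_simps)
  finally have "g (Suc n) + \<sigma> \<le> (1 - \<mu> n) * \<delta> * \<rho>"
    using den by (simp add: \<rho>_def pos_le_divide_eq)
  moreover have "0 \<le> D (Suc n)" by (simp add: D_def)
  ultimately have "(g (Suc n) + \<sigma>) * D (Suc n) \<le> (1 - \<mu> n) * \<delta> * \<rho> * D (Suc n)"
    by (rule mult_right_mono)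
  moreover have "a n * \<phi> (Suc n) \<le> a (Suc n) * \<phi> (Suc n)"
    using a_mono[of n] by (intro mult_right_mono) (simp_all add: \<phi>_def)
  ultimately show ?thesis
    using 3 unfolding energy_def \<phi>_def[symmetric]
    by (simp add: algebra_simps \<phi>_def)
qed

lemma decseq_energy:
  assumes q: "R q = q"
  shows "decseq (energy q)"
proof (rule decseq_SucI)
  fix n
  have "0 \<le> \<sigma> * D (Suc n)" using \<sigma> by (simp add: D_def)
  then show "energy q (Suc n) \<le> energy q n" using energy_decrease[OF q, of n] by linarith
qed

text \<open>The energy has a negative part, so its lower bound takes an argument. As it never
  exceeds its initial value, each squared distance is at most \<open>\<alpha>\<close> times the
  previous one plus a constant, and \<open>\<alpha> < 1\<close> keeps this recursion
  bounded.\<close>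

lemma distance_bounded:
  assumes q: "R q = q"
  obtains C where "\<And>n. (norm (w n - q))\<^sup>2 \<le> C" "\<And>n. - (\<alpha> * C) \<le> energy q n"
proof -
  have e0: "energy q n \<le> energy q 0" for n
    using decseq_energy[OF q] by (simp add: decseqD)
  \<comment> \<open>Large enough for the first distance, and preserved by the recursion because
    \<open>\<alpha> * C + \<bar>energy q 0\<bar> \<le> C\<close>.\<close>
  define C where "C = (norm (w 0 - q))\<^sup>2 + \<bar>energy q 0\<bar> / (1 - \<alpha>)"
  have "0 \<le> (1 - \<alpha>) * (norm (w 0 - q))\<^sup>2" using \<alpha> by simp
  moreover have "(1 - \<alpha>) * C = (1 - \<alpha>) * (norm (w 0 - q))\<^sup>2 + \<bar>energy q 0\<bar>"
    using \<alpha> by (simp add: C_def distrib_left)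
  ultimately have C: "\<alpha> * C + \<bar>energy q 0\<bar> \<le> C"
    by (simp add: left_diff_distrib)
  have gD: "0 \<le> g n * D n" for n using g_nonneg by (simp add: D_def)
  have bound: "(norm (w n - q))\<^sup>2 \<le> C" for n
  proof (induction n)
    case 0 then show ?case using \<alpha> by (simp add: C_def)
  next
    case (Suc n)
    have "(norm (w (Suc n) - q))\<^sup>2 \<le> energy q n + a n * (norm (w n - q))\<^sup>2"
      using gD[of n] by (simp add: energy_def)
    also have "a n * (norm (w n - q))\<^sup>2 \<le> \<alpha> * C"
      using Suc a_le \<alpha>_nonneg by (intro mult_mono) auto
    finally show ?case using e0[of n] C by linarith
  qed
  moreover have "- (\<alpha> * C) \<le> energy q n" for n
  proof -
    have "a n * (norm (w n - q))\<^sup>2 \<le> \<alpha> * C"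
      using bound a_le \<alpha>_nonneg by (intro mult_mono) auto
    then show ?thesis using gD[of n] zero_le_power2[of "norm (w (Suc n) - q)"] unfolding energy_def by linarith
  qed
  ultimately show thesis by (rule that)
qed

lemma energy_convergent:
  assumes q: "R q = q"
  shows "convergent (energy q)"
proof -
  obtain C where C: "\<And>n. - (\<alpha> * C) \<le> energy q n" using distance_bounded[OF q] by metis
  then show ?thesis using decseq_energy[OF q] decseq_convergent unfolding convergent_def by metis
qed

text \<open>Each step lowers the convergent energy by at least \<open>\<sigma> * D (Suc n)\<close>,
  so these terms tend to 0.\<close>

lemma increments_tendsto_0:
  assumes q: "R q = q"
  shows "(\<lambda>n. w (Suc n) - w n) \<longlonglongrightarrow> 0"
proof -
  obtain L where L: "energy q \<longlonglongrightarrow> L" using energy_convergent[OF q] by (auto simp: convergent_def)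
  have "(\<lambda>n. (energy q n - energy q (Suc n)) / \<sigma>) \<longlonglongrightarrow> (L - L) / \<sigma>"
    using \<sigma> by (intro tendsto_intros L LIMSEQ_Suc) auto
  then have "(\<lambda>n. (energy q n - energy q (Suc n)) / \<sigma>) \<longlonglongrightarrow> 0" by simp
  moreover have "norm (D (Suc n)) \<le> (energy q n - energy q (Suc n)) / \<sigma>" for n
  proof -
    have "norm (D (Suc n)) = D (Suc n)" by (simp add: D_def)
    moreover have "D (Suc n) * \<sigma> \<le> energy q n - energy q (Suc n)"
      using energy_decrease[OF q, of n] by (simp add: mult.commute)
    ultimately show ?thesis using \<sigma> by (simp add: pos_le_divide_eq)
  qed
  ultimately have "(\<lambda>n. D (Suc n)) \<longlonglongrightarrow> 0"
    by (intro Lim_null_comparison[OF always_eventually, of "\<lambda>n. D (Suc n)"] allI)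
  then have "D \<longlonglongrightarrow> 0" by (rule LIMSEQ_imp_Suc)
  then have "(\<lambda>n. sqrt (D n)) \<longlonglongrightarrow> sqrt 0" by (rule tendsto_real_sqrt)
  then show ?thesis by (simp add: D_def tendsto_norm_zero_iff)
qed

text \<open>The monotone weights \<open>a n\<close> have a limit \<open>b < 1\<close>. Replacing
  them by \<open>b\<close> costs a null sequence, so convergence of the energy turns into a linear
  recursion with factor \<open>b\<close> for the squared distances.\<close>

lemma distance_convergent:
  assumes q: "R q = q"
  shows "convergent (\<lambda>n. norm (w n - q))"
proof -
  obtain C where C: "\<And>n. (norm (w n - q))\<^sup>2 \<le> C" using distance_bounded[OF q] by metis
  obtain L where L: "energy q \<longlonglongrightarrow> L" using energy_convergent[OF q] by (auto simp: convergent_def)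
  obtain b where b: "a \<longlonglongrightarrow> b"
    using incseq_convergent[of a \<alpha>] a_mono a_le by (metis incseq_SucI)
  have b0: "0 \<le> b" using b a_nonneg by (intro LIMSEQ_le_const[OF b]) auto
  have "b \<le> \<alpha>" using b a_le by (intro LIMSEQ_le_const2[OF b]) auto
  then have b1: "b < 1" using \<alpha> by simp
  have "(\<lambda>n. (norm (w (Suc n) - w n))\<^sup>2) \<longlonglongrightarrow> (norm (0::'h))\<^sup>2"
    by (intro tendsto_intros increments_tendsto_0[OF q])
  then have D0: "D \<longlonglongrightarrow> 0" by (simp add: D_def[abs_def])
  have "(\<lambda>n. g n * D n) \<longlonglongrightarrow> 0"
  proof (rule Lim_null_comparison)
    have "norm (g n * D n) \<le> K * D n" for n
      using g_nonneg[of n] g_le[of n] \<sigma> by (auto simp: D_def abs_mult intro!: mult_right_mono)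
    then show "\<forall>\<^sub>F n in sequentially. norm (g n * D n) \<le> K * D n" by simp
    show "(\<lambda>n. K * D n) \<longlonglongrightarrow> 0" using tendsto_mult_left[OF D0, of K] by simp
  qed
  moreover have "(\<lambda>n. (a n - b) * (norm (w n - q))\<^sup>2) \<longlonglongrightarrow> 0"
  proof (rule Lim_null_comparison)
    show "\<forall>\<^sub>F n in sequentially. norm ((a n - b) * (norm (w n - q))\<^sup>2) \<le> \<bar>a n - b\<bar> * C"
      using C by (auto simp: abs_mult intro!: mult_left_mono always_eventually)
    have "(\<lambda>n. \<bar>a n - b\<bar> * C) \<longlonglongrightarrow> \<bar>b - b\<bar> * C" by (intro tendsto_intros b)
    then show "(\<lambda>n. \<bar>a n - b\<bar> * C) \<longlonglongrightarrow> 0" by simp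
  qed
  ultimately have "(\<lambda>n. energy q n - g n * D n + (a n - b) * (norm (w n - q))\<^sup>2) \<longlonglongrightarrow> L - 0 + 0"
    by (intro tendsto_intros L)
  then have lim: "(\<lambda>n. (norm (w (Suc n) - q))\<^sup>2 - b * (norm (w n - q))\<^sup>2) \<longlonglongrightarrow> L"
    by (simp add: energy_def algebra_simps)
  \<comment> \<open>The fixed point of the limiting recursion; subtracting it leaves a perturbed
    contraction.\<close>
  define l where "l = L / (1 - b)"
  have "(\<lambda>n. ((norm (w (Suc n) - q))\<^sup>2 - l) - b * ((norm (w n - q))\<^sup>2 - l)) \<longlonglongrightarrow> L - (1 - b) * l"
    using tendsto_diff[OF lim tendsto_const[of "(1 - b) * l"]] by (simp add: algebra_simps)
  then have "(\<lambda>n. ((norm (w (Suc n) - q))\<^sup>2 - l) - b * ((norm (w n - q))\<^sup>2 - l)) \<longlonglongrightarrow> 0"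
    using b1 by (simp add: l_def)
  then have "(\<lambda>n. (norm (w n - q))\<^sup>2 - l) \<longlonglongrightarrow> 0"
    by (rule perturbed_contraction_tendsto_0[OF b0 b1])
  then have "(\<lambda>n. (norm (w n - q))\<^sup>2) \<longlonglongrightarrow> l" by (rule LIM_zero_cancel)
  then have "(\<lambda>n. sqrt ((norm (w n - q))\<^sup>2)) \<longlonglongrightarrow> sqrt l" by (rule tendsto_real_sqrt)
  then show ?thesis by (auto simp: convergent_def)
qed

lemma extrapolation_tendsto_0:
  assumes q: "R q = q"
  shows "(\<lambda>n. a n *\<^sub>R (w (Suc n) - w n)) \<longlonglongrightarrow> 0"
proof (rule Lim_null_comparison)
  show "\<forall>\<^sub>F n in sequentially. norm (a n *\<^sub>R (w (Suc n) - w n)) \<le> \<alpha> * norm (w (Suc n) - w n)"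
    using a_nonneg a_le by (auto intro!: mult_right_mono always_eventually)
  have "(\<lambda>n. \<alpha> * norm (w (Suc n) - w n)) \<longlonglongrightarrow> \<alpha> * norm (0::'h)"
    by (intro tendsto_intros increments_tendsto_0[OF q])
  then show "(\<lambda>n. \<alpha> * norm (w (Suc n) - w n)) \<longlonglongrightarrow> 0" by simp
qed

lemma residual_tendsto_0:
  assumes q: "R q = q"
  shows "(\<lambda>n. R (s n) - s n) \<longlonglongrightarrow> 0"
proof (rule Lim_null_comparison)
  define r where "r = (\<lambda>n. (w (Suc (Suc n)) - w (Suc n)) - a n *\<^sub>R (w (Suc n) - w n))"
  have "norm (R (s n) - s n) \<le> norm (r n) / m" for n
  proof -
    have "\<mu> n *\<^sub>R (R (s n) - s n) = r n"
      unfolding r_def w_step by (simp add: s_def algebra_simps)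
    then have "\<mu> n * norm (R (s n) - s n) = norm (r n)"
      using \<mu>_pos[of n] by (metis norm_scaleR abs_of_pos)
    moreover have "m * norm (R (s n) - s n) \<le> \<mu> n * norm (R (s n) - s n)"
      using \<mu>_ge by (intro mult_right_mono) auto
    ultimately show ?thesis using m by (simp add: pos_le_divide_eq mult.commute)
  qed
  then show "\<forall>\<^sub>F n in sequentially. norm (R (s n) - s n) \<le> norm (r n) / m" by simp
  have "(\<lambda>n. norm (r n) / m) \<longlonglongrightarrow> norm (0 - 0 :: 'h) / m"
    unfolding r_def using m
    by (intro tendsto_intros LIMSEQ_Suc[OF increments_tendsto_0[OF q]] extrapolation_tendsto_0[OF q]) auto
  then show "(\<lambda>n. norm (r n) / m) \<longlonglongrightarrow> 0" by simp
qed

text \<open>The residual is known to vanish along \<open>s\<close>, so the weak convergence argument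
  is run there. Distances from \<open>s n\<close> and from \<open>w (Suc n)\<close> to a fixed point
  differ by at most the vanishing extrapolation.\<close>

lemma weakly_converges_fixed_point:
  assumes "\<exists>q. R q = q"
  shows "\<exists>c. R c = c \<and> weakly_converges s c"
proof -
  obtain q where q: "R q = q" using assms by blast
  show ?thesis
  proof (rule asymptotically_regular_weakly_converges[OF nonexp residual_tendsto_0[OF q] assms])
    fix y assume y: "R y = y"
    obtain l where "(\<lambda>n. norm (w n - y)) \<longlonglongrightarrow> l"
      using distance_convergent[OF y] by (auto simp: convergent_def)
    then have "(\<lambda>n. norm (w (Suc n) - y)) \<longlonglongrightarrow> l" by (rule LIMSEQ_Suc)
    moreover have "(\<lambda>n. norm (s n - y) - norm (w (Suc n) - y)) \<longlonglongrightarrow> 0"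
    proof (rule Lim_null_comparison[OF always_eventually tendsto_norm_zero[OF extrapolation_tendsto_0[OF q]]], rule allI)
      fix n
      have "(s n - y) - (w (Suc n) - y) = a n *\<^sub>R (w (Suc n) - w n)" by (simp add: s_def)
      then show "norm (norm (s n - y) - norm (w (Suc n) - y)) \<le> norm (a n *\<^sub>R (w (Suc n) - w n))"
        using norm_triangle_ineq3[of "s n - y" "w (Suc n) - y"] by simp
    qed
    ultimately have "(\<lambda>n. norm (w (Suc n) - y) + (norm (s n - y) - norm (w (Suc n) - y))) \<longlonglongrightarrow> l + 0"
      by (rule tendsto_add)
    then show "convergent (\<lambda>n. norm (s n - y))" by (auto simp: convergent_def)
  qed
qed

end

section \<open>The inertial Douglas--Rachford iteration\<close>

lemma subdiffD:
  assumes "v \<in> subdiff f x" "f x = ereal a" "f y = ereal b"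
  shows "a + v \<bullet> (y - x) \<le> b"
proof -
  have "f x + ereal (v \<bullet> (y - x)) \<le> f y" using assms(1) by (simp add: subdiff_def)
  then show ?thesis by (simp add: assms(2,3))
qed

lemma subdiff_finite:
  assumes "v \<in> subdiff f x"
  obtains a where "f x = ereal a"
  using assms by (cases "f x") (auto simp: subdiff_def)

lemma subdiff_monotone:
  assumes "a \<in> subdiff f x" "b \<in> subdiff f y"
  shows "0 \<le> (a - b) \<bullet> (x - y)"
proof -
  obtain r where r: "f x = ereal r" using assms(1) by (rule subdiff_finite)
  obtain t where t: "f y = ereal t" using assms(2) by (rule subdiff_finite)
  show ?thesis
    using subdiffD[OF assms(1) r t] subdiffD[OF assms(2) t r]
    by (simp add: inner_diff_left inner_diff_right)
qed

lemma weakly_converges_bounded: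
  fixes X :: "nat \<Rightarrow> 'a::{real_inner, complete_space}"
  assumes "weakly_converges X l"
  shows "\<exists>K. \<forall>n. norm (X n) \<le> K"
proof (rule uniform_boundedness_subspace[of UNIV])
  fix v
  have "Bseq (\<lambda>n. X n \<bullet> v)"
    using assms unfolding weakly_converges_def by (intro convergent_imp_Bseq) (auto simp: convergent_def)
  then show "\<exists>C. \<forall>k. X k \<bullet> v \<le> C"
    unfolding Bseq_def by (metis abs_le_D1 real_norm_def)
qed auto

lemma tendsto_inner_bounded_null:
  fixes X Z :: "nat \<Rightarrow> 'a::real_inner"
  assumes "\<And>n. norm (X n) \<le> K" "Z \<longlonglongrightarrow> 0"
  shows "(\<lambda>n. X n \<bullet> Z n) \<longlonglongrightarrow> 0"
proof (rule Lim_null_comparison)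
  have "norm (X n \<bullet> Z n) \<le> K * norm (Z n)" for n
    using Cauchy_Schwarz_ineq2[of "X n" "Z n"] mult_right_mono[OF assms(1), of "norm (Z n)" n] by simp
  then show "\<forall>\<^sub>F n in sequentially. norm (X n \<bullet> Z n) \<le> K * norm (Z n)" by simp
  have "(\<lambda>n. K * norm (Z n)) \<longlonglongrightarrow> K * norm (0::'a)" by (intro tendsto_intros assms(2))
  then show "(\<lambda>n. K * norm (Z n)) \<longlonglongrightarrow> 0" by simp
qed

lemma weakly_converges_add_null:
  assumes "weakly_converges X l" "Z \<longlonglongrightarrow> 0"
  shows "weakly_converges (\<lambda>n. X n + Z n) l"
  unfolding weakly_converges_def
proof
  fix u
  have "(\<lambda>n. X n \<bullet> u + Z n \<bullet> u) \<longlonglongrightarrow> l \<bullet> u + 0 \<bullet> u"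
    using assms(1) unfolding weakly_converges_def
    by (intro tendsto_add tendsto_inner[OF assms(2) tendsto_const]) blast
  then show "(\<lambda>n. (X n + Z n) \<bullet> u) \<longlonglongrightarrow> l \<bullet> u" by (simp add: inner_add_left)
qed

lemma weakly_converges_offset:
  assumes "weakly_converges (\<lambda>n. X (n + k)) l"
  shows "weakly_converges X l"
  using assms unfolding weakly_converges_def by (auto intro: LIMSEQ_offset[of _ k])

section \<open>Proximal maps and the Douglas-Rachford operator\<close>

context orthogonal_projection
begin

text \<open>Chosen by its optimality condition, the form in which the algorithm delivers it.
  Existence comes from \<open>penalized_minimizer\<close> with \<open>N = 0\<close>, uniqueness from
  monotonicity of the subdifferential.\<close>

definition prox :: "real \<Rightarrow> ('h \<Rightarrow> ereal) \<Rightarrow> 'h \<Rightarrow> 'h" where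
  "prox \<gamma> F s = (SOME p. \<gamma> *\<^sub>R (s - p) \<in> subdiff F p)"

lemma prox_subdiff:
  assumes "F \<in> Gamma_class" "\<gamma> > 0"
  shows "\<gamma> *\<^sub>R (s - prox \<gamma> F s) \<in> subdiff F (prox \<gamma> F s)"
proof -
  obtain p where "- (0 *\<^sub>R (p - Pr p) + \<gamma> *\<^sub>R (p - s)) \<in> subdiff F p"
    using penalized_minimizer[OF assms, of 0] by blast
  then have "\<gamma> *\<^sub>R (s - p) \<in> subdiff F p" by (simp add: algebra_simps)
  then show ?thesis unfolding prox_def by (rule someI)
qed

lemma prox_firmly_nonexpansive:
  assumes "F \<in> Gamma_class" "\<gamma> > 0"
  shows "0 \<le> ((s - prox \<gamma> F s) - (t - prox \<gamma> F t)) \<bullet> (prox \<gamma> F s - prox \<gamma> F t)"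
proof -
  have "0 \<le> \<gamma> * (((s - prox \<gamma> F s) - (t - prox \<gamma> F t)) \<bullet> (prox \<gamma> F s - prox \<gamma> F t))"
    using subdiff_monotone[OF prox_subdiff[OF assms, of s] prox_subdiff[OF assms, of t]]
    by (simp flip: scaleR_diff_right)
  then show ?thesis using assms(2) by (simp add: zero_le_mult_iff)
qed

lemma prox_eqI:
  assumes "F \<in> Gamma_class" "\<gamma> > 0" "\<gamma> *\<^sub>R (s - p) \<in> subdiff F p"
  shows "prox \<gamma> F s = p"
proof -
  have "0 \<le> (\<gamma> *\<^sub>R (s - prox \<gamma> F s) - \<gamma> *\<^sub>R (s - p)) \<bullet> (prox \<gamma> F s - p)"
    by (rule subdiff_monotone[OF prox_subdiff[OF assms(1,2)] assms(3)])
  also have "\<gamma> *\<^sub>R (s - prox \<gamma> F s) - \<gamma> *\<^sub>R (s - p) = - (\<gamma> *\<^sub>R (prox \<gamma> F s - p))"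
    by (simp add: algebra_simps)
  also have "\<dots> \<bullet> (prox \<gamma> F s - p) = - (\<gamma> * (norm (prox \<gamma> F s - p))\<^sup>2)"
    by (simp add: power2_norm_eq_inner)
  finally show ?thesis using assms(2) by (simp add: mult_le_0_iff)
qed

text \<open>The composition of the reflections belonging to \<open>Pr\<close> and to the proximal
  map; its average with the identity is the Douglas-Rachford operator.\<close>

definition dr_reflection :: "real \<Rightarrow> ('h \<Rightarrow> ereal) \<Rightarrow> 'h \<Rightarrow> 'h" where
  "dr_reflection \<gamma> F s = 2 *\<^sub>R Pr (2 *\<^sub>R prox \<gamma> F s - s) - (2 *\<^sub>R prox \<gamma> F s - s)"

text \<open>The outer reflection is an isometry; the inner one is nonexpansive because the proximal
  map is firmly nonexpansive.\<close>

lemma dr_reflection_nonexpansive: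
  assumes "F \<in> Gamma_class" "\<gamma> > 0"
  shows "norm (dr_reflection \<gamma> F s - dr_reflection \<gamma> F t) \<le> norm (s - t)"
proof -
  define p where "p = prox \<gamma> F s - prox \<gamma> F t"
  have "(2 *\<^sub>R prox \<gamma> F s - s) - (2 *\<^sub>R prox \<gamma> F t - t) = 2 *\<^sub>R p - (s - t)"
    by (simp add: p_def algebra_simps)
  moreover have "(2 *\<^sub>R Pr u - u) - (2 *\<^sub>R Pr v - v) = 2 *\<^sub>R Pr (u - v) - (u - v)" for u v
    by (simp add: diff algebra_simps)
  ultimately have "dr_reflection \<gamma> F s - dr_reflection \<gamma> F t = 2 *\<^sub>R Pr (2 *\<^sub>R p - (s - t)) - (2 *\<^sub>R p - (s - t))"
    unfolding dr_reflection_def by metis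
  then have eq: "norm (dr_reflection \<gamma> F s - dr_reflection \<gamma> F t) = norm (2 *\<^sub>R p - (s - t))"
    by (simp only: norm_reflection)
  have "0 \<le> ((s - t) - p) \<bullet> p"
    using prox_firmly_nonexpansive[OF assms, of s t] by (simp add: p_def algebra_simps)
  moreover have "(norm (2 *\<^sub>R p - (s - t)))\<^sup>2 = (norm (s - t))\<^sup>2 - 4 * (((s - t) - p) \<bullet> p)"
    unfolding power2_norm_eq_inner
    by (simp add: inner_diff_left inner_diff_right inner_commute)
  ultimately have "(norm (2 *\<^sub>R p - (s - t)))\<^sup>2 \<le> (norm (s - t))\<^sup>2" by simp
  then show ?thesis unfolding eq by (rule power2_le_imp_le) simp
qed

lemma dr_reflection_residual:
  "dr_reflection \<gamma> F s - s = 2 *\<^sub>R (Pr (2 *\<^sub>R prox \<gamma> F s - s) - prox \<gamma> F s)"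
  unfolding dr_reflection_def by (simp add: algebra_simps)

lemma inertial_douglas_rachford:
  fixes w s p Y :: "nat \<Rightarrow> 'h" and a l :: "nat \<Rightarrow> real" and \<alpha> \<delta> \<sigma> m \<gamma> :: real
  assumes F: "F \<in> Gamma_class" and \<gamma>: "\<gamma> > 0"
    and sol: "vb \<in> subdiff F xb" "Pr xb = xb" "Pr vb = 0"
    and Y: "\<And>n. Y n \<in> subdiff F (p n)" "\<And>n. Y n = \<gamma> *\<^sub>R (s n - p n)"
    and s: "\<And>n. s n = w (Suc n) + a n *\<^sub>R (w (Suc n) - w n)"
    and w: "\<And>n. w (Suc (Suc n)) = s n + l n *\<^sub>R (Pr (2 *\<^sub>R p n - s n) - p n)"
    and a: "\<And>n. a n \<le> a (Suc n)" "\<And>n. 0 \<le> a n" "\<And>n. a n \<le> \<alpha>" "\<alpha> < 1"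
    and pos: "\<delta> > 0" "\<sigma> > 0" "m > 0" and l: "\<And>n. m \<le> l n"
      "\<And>n. l n \<le> 2 * ((\<delta> - \<alpha> * (\<alpha> * (1 + \<alpha>) + \<alpha> * \<delta> + \<sigma>)) / (\<delta> * (1 + \<alpha> * (1 + \<alpha>) + \<alpha> * \<delta> + \<sigma>)))"
  obtains pb yb where "yb \<in> subdiff F pb" "Pr pb = pb" "Pr yb = 0"
    "weakly_converges p pb" "weakly_converges Y yb"
    "(\<lambda>n. a n *\<^sub>R (w (Suc n) - w n)) \<longlonglongrightarrow> 0"
    "(\<lambda>n. Pr (2 *\<^sub>R p n - s n) - p n) \<longlonglongrightarrow> 0"
    "(\<lambda>n. Y n \<bullet> (p n - pb)) \<longlonglongrightarrow> 0"
proof -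
  define R where "R = dr_reflection \<gamma> F"
  have p: "p n = prox \<gamma> F (s n)" for n
    using prox_eqI[OF F \<gamma>] Y(1)[of n] unfolding Y(2) by metis
  interpret km: inertial_km R w s a "\<lambda>n. l n / 2" \<alpha> \<delta> \<sigma> "m / 2"
  proof
    show "norm (R x - R y) \<le> norm (x - y)" for x y
      unfolding R_def by (rule dr_reflection_nonexpansive[OF F \<gamma>])
    \<comment> \<open>The residual of the reflection is twice the correction in the iteration, hence
      the halved relaxation.\<close>
    show "w (Suc (Suc n)) = s n + (l n / 2) *\<^sub>R (R (s n) - s n)" for n
      unfolding w R_def dr_reflection_residual p by simp
    show "l n / 2 \<le> (\<delta> - \<alpha> * (\<alpha> * (1 + \<alpha>) + \<alpha> * \<delta> + \<sigma>)) / (\<delta> * (1 + \<alpha> * (1 + \<alpha>) + \<alpha> * \<delta> + \<sigma>))" for n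
      using l(2)[of n] by linarith
  qed (use s a pos l(1) in auto)
  have fixed_iff: "R c = c \<longleftrightarrow> Pr (2 *\<^sub>R prox \<gamma> F c - c) = prox \<gamma> F c" for c
    using dr_reflection_residual[of \<gamma> F c] unfolding R_def by auto
  \<comment> \<open>A solution and its multiplier combine into a fixed point whose proximal point is
    \<open>xb\<close>.\<close>
  have "R (xb + (1 / \<gamma>) *\<^sub>R vb) = xb + (1 / \<gamma>) *\<^sub>R vb"
  proof -
    have "prox \<gamma> F (xb + (1 / \<gamma>) *\<^sub>R vb) = xb"
      using \<gamma> sol(1) by (intro prox_eqI[OF F \<gamma>]) simp
    then show ?thesis unfolding fixed_iff by (simp add: diff add scale sol scaleR_2)
  qed
  then have ex: "\<exists>q. R q = q" by blast
  then obtain c where c: "R c = c" "weakly_converges s c"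
    using km.weakly_converges_fixed_point by blast
  define pb where "pb = prox \<gamma> F c"
  define yb where "yb = \<gamma> *\<^sub>R (c - pb)"
  have yb: "yb \<in> subdiff F pb"
    unfolding yb_def pb_def by (rule prox_subdiff[OF F \<gamma>])
  have c_fix: "Pr (2 *\<^sub>R pb - c) = pb" using c(1) unfolding fixed_iff pb_def .
  then have Pr_pb: "Pr pb = pb" by (metis idem)
  have Pr_c: "Pr c = pb" using c_fix by (simp add: add diff Pr_pb scaleR_2)
  have Pr_yb: "Pr yb = 0" by (simp add: yb_def scale diff Pr_pb Pr_c)
  define e where "e = (\<lambda>n. Pr (2 *\<^sub>R p n - s n) - p n)"
  have e0: "e \<longlonglongrightarrow> 0"
  proof -
    have "(\<lambda>n. (1/2) *\<^sub>R (R (s n) - s n)) \<longlonglongrightarrow> (1/2) *\<^sub>R 0"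
      by (intro tendsto_intros km.residual_tendsto_0[OF c(1)])
    then show ?thesis unfolding R_def dr_reflection_residual p[symmetric] e_def by simp
  qed
  have Pre0: "(\<lambda>n. Pr (e n)) \<longlonglongrightarrow> 0"
    using tendsto[OF e0] by (simp add: linear_0[OF linear])
  have PrY: "Pr (Y n) = - (\<gamma> *\<^sub>R Pr (e n))" for n
    by (simp add: e_def Y(2) diff scale add idem algebra_simps scaleR_2)
  have PrY0: "(\<lambda>n. Pr (Y n)) \<longlonglongrightarrow> 0"
    unfolding PrY using tendsto_minus[OF tendsto_scaleR[OF tendsto_const Pre0, of \<gamma>]] by simp
  have pP: "p n - Pr (p n) = Pr (e n) - e n" for n
    by (simp add: e_def diff idem)
  have pP0: "(\<lambda>n. p n - Pr (p n)) \<longlonglongrightarrow> 0"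
    unfolding pP using tendsto_diff[OF Pre0 e0] by simp
  \<comment> \<open>Proximal maps are not weakly continuous in general, so the weak limit of
    \<open>p\<close> is reached through the linear map \<open>Pr\<close>: \<open>Pr (p n)\<close> is
    \<open>Pr (s n)\<close> plus a null sequence, and \<open>p n - Pr (p n)\<close>
    vanishes.\<close>
  have weak_Prp: "weakly_converges (\<lambda>n. Pr (p n)) pb"
  proof -
    have "weakly_converges (\<lambda>n. Pr (s n)) pb"
      using c(2) unfolding weakly_converges_def selfadjoint Pr_c[symmetric] by blast
    then have "weakly_converges (\<lambda>n. Pr (s n) + Pr (e n)) pb"
      by (rule weakly_converges_add_null[OF _ Pre0])
    also have "(\<lambda>n. Pr (s n) + Pr (e n)) = (\<lambda>n. Pr (p n))"
      by (simp add: e_def diff add idem scale scaleR_2)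
    finally show ?thesis .
  qed
  have weak_p: "weakly_converges p pb"
    using weakly_converges_add_null[OF weak_Prp pP0] by simp
  have weak_Y: "weakly_converges Y yb"
    unfolding weakly_converges_def
  proof
    fix u
    have "(\<lambda>n. \<gamma> * (s n \<bullet> u - p n \<bullet> u)) \<longlonglongrightarrow> \<gamma> * (c \<bullet> u - pb \<bullet> u)"
      using c(2) weak_p unfolding weakly_converges_def
      by (intro tendsto_mult tendsto_diff tendsto_const) blast+
    then show "(\<lambda>n. Y n \<bullet> u) \<longlonglongrightarrow> yb \<bullet> u" by (simp add: Y(2) yb_def inner_diff_left)
  qed
  \<comment> \<open>Weak convergence of both factors would not suffice. Splitting along range and
    kernel of \<open>Pr\<close> pairs, in each part, a bounded factor with one that tends to 0 in
    norm.\<close>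
  have inner0: "(\<lambda>n. Y n \<bullet> (p n - pb)) \<longlonglongrightarrow> 0"
  proof -
    obtain K1 where K1: "\<And>n. norm (Y n) \<le> K1" using weakly_converges_bounded[OF weak_Y] by blast
    obtain K2 where K2: "\<And>n. norm (Pr (p n)) \<le> K2" using weakly_converges_bounded[OF weak_Prp] by blast
    have "norm (Pr (p n) - pb) \<le> K2 + norm pb" for n
      using norm_triangle_ineq4[of "Pr (p n)" pb] K2[of n] by simp
    then have "(\<lambda>n. (Pr (p n) - pb) \<bullet> Pr (Y n)) \<longlonglongrightarrow> 0"
      by (rule tendsto_inner_bounded_null[OF _ PrY0])
    moreover have "norm (Y n - Pr (Y n)) \<le> K1" for n
      using norm_diff_le[of "Y n"] K1[of n] by simp
    then have "(\<lambda>n. (Y n - Pr (Y n)) \<bullet> (p n - Pr (p n))) \<longlonglongrightarrow> 0"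
      by (rule tendsto_inner_bounded_null[OF _ pP0])
    ultimately have "(\<lambda>n. (Pr (p n) - pb) \<bullet> Pr (Y n) + (Y n - Pr (Y n)) \<bullet> (p n - Pr (p n))) \<longlonglongrightarrow> 0 + 0"
      by (rule tendsto_add)
    moreover have "Y n \<bullet> (p n - pb) = (Pr (p n) - pb) \<bullet> Pr (Y n) + (Y n - Pr (Y n)) \<bullet> (p n - Pr (p n))" for n
      using inner_split[of "Y n" "p n - pb"] by (simp add: diff Pr_pb inner_commute)
    ultimately show ?thesis by simp
  qed
  show thesis
    using that[OF yb Pr_pb Pr_yb weak_p weak_Y km.extrapolation_tendsto_0[OF c(1)]] e0 inner0
    unfolding e_def by blast
qed

text \<open>The subgradient inequalities at \<open>pb\<close> and at \<open>p n\<close> enclose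
  \<open>F (p n)\<close> between two sequences with limit \<open>F pb\<close>.\<close>

lemma values_tendsto:
  assumes yb: "yb \<in> subdiff F pb" and Y: "\<And>n. Y n \<in> subdiff F (p n)"
    and weak: "weakly_converges p pb" and inner0: "(\<lambda>n. Y n \<bullet> (p n - pb)) \<longlonglongrightarrow> 0"
  shows "(\<lambda>n. F (p n)) \<longlonglongrightarrow> F pb"
proof -
  obtain b where b: "F pb = ereal b" using yb by (rule subdiff_finite)
  have "\<exists>r. F (p n) = ereal r" for n using Y[of n] by (metis subdiff_finite)
  then obtain fp where fp: "\<And>n. F (p n) = ereal (fp n)" by metis
  have "(\<lambda>n. b + yb \<bullet> (p n - pb)) \<longlonglongrightarrow> b + (pb \<bullet> yb - pb \<bullet> yb)"
    using weak unfolding inner_diff_right inner_commute[of yb] weakly_converges_def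
    by (intro tendsto_add tendsto_diff tendsto_const) blast
  then have low: "(\<lambda>n. b + yb \<bullet> (p n - pb)) \<longlonglongrightarrow> b" by simp
  have up: "(\<lambda>n. b + Y n \<bullet> (p n - pb)) \<longlonglongrightarrow> b" using tendsto_add[OF tendsto_const inner0, of b] by simp
  have 1: "b + yb \<bullet> (p n - pb) \<le> fp n" for n by (rule subdiffD[OF yb b fp])
  have 2: "fp n \<le> b + Y n \<bullet> (p n - pb)" for n
    using subdiffD[OF Y fp b, of n] by (simp add: inner_diff_right)
  have "fp \<longlonglongrightarrow> b"
    by (rule tendsto_sandwich[OF _ _ low up]) (simp_all add: 1 2)
  then show ?thesis by (simp add: fp b)
qed

end

section \<open>The product space\<close>

lemma conjugate_ge: "ereal (u \<bullet> x) - f x \<le> conjugate f u"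
  unfolding conjugate_def by (rule SUP_upper) simp

lemma conjugate_subdiff:
  assumes v: "v \<in> subdiff f x" and r: "f x = ereal r"
  shows "conjugate f v = ereal (v \<bullet> x - r)"
proof (rule antisym)
  show "conjugate f v \<le> ereal (v \<bullet> x - r)"
    unfolding conjugate_def
  proof (rule SUP_least)
    fix y
    have "f x + ereal (v \<bullet> (y - x)) \<le> f y" using v by (simp add: subdiff_def)
    then show "ereal (v \<bullet> y) - f y \<le> ereal (v \<bullet> x - r)"
      by (cases "f y") (auto simp: r inner_diff_right)
  qed
  show "ereal (v \<bullet> x - r) \<le> conjugate f v"
    using conjugate_ge[of v x f] by (simp add: r)
qed

lemma subdiff_of_conjugate_le:
  assumes r: "f x = ereal r" and le: "conjugate f v \<le> ereal (v \<bullet> x - r)"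
  shows "v \<in> subdiff f x"
proof -
  have "f x + ereal (v \<bullet> (y - x)) \<le> f y" for y
  proof -
    have "ereal (v \<bullet> y) - f y \<le> ereal (v \<bullet> x - r)"
      using conjugate_ge[of v y f] le by (rule order_trans)
    then show ?thesis by (cases "f y") (auto simp: r inner_diff_right)
  qed
  then show ?thesis by (simp add: subdiff_def r)
qed

text \<open>At the midpoint of \<open>a\<close> and \<open>b\<close> the conjugate is bounded above
  by strong convexity and below by the Fenchel-Young inequality at \<open>x\<close> and at
  \<open>y\<close>. Adding up gives strong monotonicity with half the modulus, which later turns
  vanishing inner products into norm convergence.\<close>

lemma strongly_convex_conjugate_subdiff:
  assumes "strongly_convex (conjugate f)"
  shows "\<exists>\<beta>>0. \<forall>x y a b. a \<in> subdiff f x \<longrightarrow> b \<in> subdiff f y \<longrightarrow>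
    \<beta> * (norm (a - b))\<^sup>2 \<le> (x - y) \<bullet> (a - b)"
proof -
  obtain \<beta> where \<beta>: "\<beta> > 0" and conv: "\<And>u v t. u \<in> edom (conjugate f) \<Longrightarrow> v \<in> edom (conjugate f) \<Longrightarrow>
     t \<in> {0<..<1} \<Longrightarrow> conjugate f (t *\<^sub>R u + (1 - t) *\<^sub>R v) + ereal (t * (1 - t) * (\<beta> / 2) * (norm (u - v))\<^sup>2)
       \<le> ereal t * conjugate f u + ereal (1 - t) * conjugate f v"
    using assms unfolding strongly_convex_def by blast
  have "\<beta> / 2 * (norm (a - b))\<^sup>2 \<le> (x - y) \<bullet> (a - b)"
    if a: "a \<in> subdiff f x" and b: "b \<in> subdiff f y" for x y a b
  proof -
    obtain r where r: "f x = ereal r" using a by (rule subdiff_finite)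
    obtain t where t: "f y = ereal t" using b by (rule subdiff_finite)
    define N where "N = \<beta> * (norm (a - b))\<^sup>2"
    define c where "c = (1/2) *\<^sub>R a + (1 - 1/2) *\<^sub>R b"
    have "conjugate f c + ereal (1 / 2 * (1 - 1 / 2) * (\<beta> / 2) * (norm (a - b))\<^sup>2)
        \<le> ereal (1/2) * conjugate f a + ereal (1 - 1/2) * conjugate f b"
      unfolding c_def using conjugate_subdiff[OF a r] conjugate_subdiff[OF b t]
      by (intro conv) (auto simp: edom_def)
    also have "\<dots> = ereal ((a \<bullet> x - r) / 2 + (b \<bullet> y - t) / 2)"
      by (simp add: conjugate_subdiff[OF a r] conjugate_subdiff[OF b t])
    also have "1 / 2 * (1 - 1 / 2) * (\<beta> / 2) * (norm (a - b))\<^sup>2 = N / 8" by (simp add: N_def)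
    finally have *: "conjugate f c + ereal (N / 8) \<le> ereal ((a \<bullet> x - r) / 2 + (b \<bullet> y - t) / 2)" .
    have "ereal (c \<bullet> x - r) \<le> conjugate f c" "ereal (c \<bullet> y - t) \<le> conjugate f c"
      using conjugate_ge[of c x f] conjugate_ge[of c y f] by (simp_all add: r t)
    with * have "c \<bullet> x - r + N / 8 \<le> (a \<bullet> x - r) / 2 + (b \<bullet> y - t) / 2"
      "c \<bullet> y - t + N / 8 \<le> (a \<bullet> x - r) / 2 + (b \<bullet> y - t) / 2"
      by (cases "conjugate f c"; simp)+
    then have "c \<bullet> x + c \<bullet> y + N / 4 \<le> a \<bullet> x + b \<bullet> y"
      by (simp add: field_simps)
    moreover have "c \<bullet> x + c \<bullet> y = a \<bullet> x + b \<bullet> y - (x - y) \<bullet> (a - b) / 2"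
      by (simp add: c_def inner_add_left inner_diff_left inner_diff_right inner_commute[of x] inner_commute[of y] field_simps)
    ultimately show ?thesis by (simp add: N_def)
  qed
  then show ?thesis using \<beta> by (intro exI[of _ "\<beta> / 2"]) auto
qed

section \<open>The diagonal and separable sums\<close>

definition diagonal_proj :: "'a::real_inner ^ 'm::finite \<Rightarrow> 'a ^ 'm" where
  "diagonal_proj u = (\<chi> i. (1 / real CARD('m)) *\<^sub>R (\<Sum>j\<in>UNIV. u $ j))"

lemma diagonal_proj_nth [simp]:
  "diagonal_proj u $ i = (1 / real CARD('m)) *\<^sub>R (\<Sum>j\<in>UNIV. u $ j)" for u :: "'a::real_inner ^ 'm::finite"
  by (simp add: diagonal_proj_def)

lemma orthogonal_projection_diagonal:
  "orthogonal_projection (diagonal_proj :: 'a::{real_inner, complete_space} ^ 'm::finite \<Rightarrow> 'a ^ 'm)"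
proof (rule orthogonal_projection.intro)
  show "linear (diagonal_proj :: 'a ^ 'm \<Rightarrow> 'a ^ 'm)"
    by (rule linearI)
      (simp_all add: vec_eq_iff sum.distrib scaleR_add_right scaleR_sum_right[symmetric] scaleR_left_commute)
  fix x y :: "'a ^ 'm"
  show "diagonal_proj (diagonal_proj x) = diagonal_proj x"
    by (simp add: vec_eq_iff sum_constant_scaleR)
  show "diagonal_proj x \<bullet> y = x \<bullet> diagonal_proj y"
    by (simp add: inner_vec_def flip: inner_sum_left inner_sum_right sum_divide_distrib)
qed

interpretation diag: orthogonal_projection diagonal_proj
  by (rule orthogonal_projection_diagonal)

lemma diagonal_proj_eq_0_iff: "diagonal_proj u = 0 \<longleftrightarrow> (\<Sum>i\<in>UNIV. u $ i) = 0"
  for u :: "'a::real_inner ^ 'm::finite"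
  by (simp add: vec_eq_iff)

lemma diagonal_proj_const [simp]: "diagonal_proj (\<chi> i. p) = (\<chi> i. p)"
  for p :: "'a::real_inner"
  by (simp add: vec_eq_iff sum_constant_scaleR)

lemma diagonal_proj_fixed: "diagonal_proj d = d \<Longrightarrow> d = (\<chi> i. d $ k)"
  by (metis (no_types, lifting) diagonal_proj_nth vec_lambda_unique)

definition separable_sum :: "('m::finite \<Rightarrow> 'a \<Rightarrow> ereal) \<Rightarrow> 'a ^ 'm \<Rightarrow> ereal" where
  "separable_sum f u = (\<Sum>i\<in>UNIV. f i (u $ i))"

lemma separable_sum_real:
  assumes "\<And>i. f i (u $ i) = ereal (r i)"
  shows "separable_sum f u = ereal (\<Sum>i\<in>UNIV. r i)"
  by (simp add: separable_sum_def assms)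

lemma separable_sum_infinity:
  "f i (u $ i) = \<infinity> \<Longrightarrow> separable_sum f u = \<infinity>"
  unfolding separable_sum_def by (auto simp: sum_Pinfty)

lemma separable_sum_cases:
  assumes "\<And>i. proper_fun (f i)"
  obtains "separable_sum f u = \<infinity>" "\<exists>i. f i (u $ i) = \<infinity>"
  | r where "\<And>i. f i (u $ i) = ereal (r i)" "separable_sum f u = ereal (\<Sum>i\<in>UNIV. r i)"
proof (cases "\<exists>i. f i (u $ i) = \<infinity>")
  case True
  then show thesis using that(1) separable_sum_infinity by blast
next
  case False
  then have "\<forall>i. \<exists>r. f i (u $ i) = ereal r" using proper_fun_real[OF assms] by blast
  then obtain r where "\<And>i. f i (u $ i) = ereal (r i)" by metis
  then show thesis using that(2) separable_sum_real by blast
qed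

lemma separable_sum_Gamma_class:
  fixes f :: "'m::finite \<Rightarrow> 'a::{real_inner, complete_space} \<Rightarrow> ereal"
  assumes "\<And>i. f i \<in> Gamma_class"
  shows "separable_sum f \<in> Gamma_class"
proof -
  have P: "\<And>i. proper_fun (f i)" and C: "\<And>i. econvex (f i)" and L: "\<And>i. lower_semicont (f i)"
    using assms by (auto simp: Gamma_class_def)
  have not_MInf: "separable_sum f u \<noteq> -\<infinity>" for u
    by (cases rule: separable_sum_cases[of f u, OF P]) auto
  have "\<exists>u. separable_sum f u \<noteq> \<infinity>"
  proof -
    have "\<forall>i. \<exists>x r. f i x = ereal r" using P proper_fun_real unfolding proper_fun_def by metis
    then obtain x r where "\<And>i. f i (x i) = ereal (r i)" by metis
    then have "separable_sum f (\<chi> i. x i) = ereal (\<Sum>i\<in>UNIV. r i)" by (intro separable_sum_real) simp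
    then show ?thesis by (intro exI[of _ "\<chi> i. x i"]) simp
  qed
  with not_MInf have "proper_fun (separable_sum f)" by (simp add: proper_fun_def)
  moreover have "econvex (separable_sum f)"
    unfolding econvex_def
  proof (intro allI ballI)
    fix x y :: "'a ^ 'm" and t :: real assume "t \<in> {0<..<1}"
    then have t: "0 < t" "t < 1" by auto
    show "separable_sum f (t *\<^sub>R x + (1 - t) *\<^sub>R y)
        \<le> ereal t * separable_sum f x + ereal (1 - t) * separable_sum f y"
    proof (cases rule: separable_sum_cases[of f x, OF P])
      case 1
      then show ?thesis using t not_MInf[of y] by (cases "separable_sum f y") auto
    next
      case x: (2 r)
      show ?thesis
      proof (cases rule: separable_sum_cases[of f y, OF P])
        case 1 then show ?thesis using t x(2) by auto
      next
        case y: (2 q)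
        have "separable_sum f (t *\<^sub>R x + (1 - t) *\<^sub>R y) \<le> (\<Sum>i\<in>UNIV. ereal (t * r i + (1 - t) * q i))"
          unfolding separable_sum_def using econvexD_real[OF C x(1) y(1) t] by (intro sum_mono) simp
        also have "\<dots> = ereal t * separable_sum f x + ereal (1 - t) * separable_sum f y"
          by (simp add: x(2) y(2) sum.distrib sum_distrib_left)
        finally show ?thesis .
      qed
    qed
  qed
  moreover have "lower_semicont (separable_sum f)"
  proof -
    have nth: "lower_semicont (\<lambda>u :: 'a ^ 'm. f i (u $ i))" for i
      using L[of i] unfolding lower_semicont_iff_liminf by (auto dest: tendsto_vec_nth)
    have "lower_semicont (\<lambda>u :: 'a ^ 'm. \<Sum>i\<in>A. f i (u $ i)) \<and> (\<forall>u :: 'a ^ 'm. (\<Sum>i\<in>A. f i (u $ i)) \<noteq> -\<infinity>)"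
      if "finite A" for A
      using that
    proof (induction A rule: finite_induct)
      case empty
      then show ?case using lower_semicont_continuous[of "\<lambda>_::'a^'m. 0"] by (simp add: zero_ereal_def)
    next
      case (insert i A)
      then have "lower_semicont (\<lambda>u :: 'a ^ 'm. f i (u $ i) + (\<Sum>i\<in>A. f i (u $ i)))"
        using P[of i] by (intro lower_semicont_add nth) (auto simp: proper_fun_def)
      moreover have "f i (u $ i) + (\<Sum>i\<in>A. f i (u $ i)) \<noteq> -\<infinity>" for u :: "'a ^ 'm"
        using insert.IH P[of i] by (auto simp: proper_fun_def)
      ultimately show ?case using insert.hyps by simp
    qed
    then show ?thesis unfolding separable_sum_def by simp
  qed
  ultimately show ?thesis by (simp add: Gamma_class_def)
qed

lemma subdiff_separable_sum:
  fixes f :: "'m::finite \<Rightarrow> 'a::real_inner \<Rightarrow> ereal"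
  assumes P: "\<And>i. proper_fun (f i)"
  shows "v \<in> subdiff (separable_sum f) u \<longleftrightarrow> (\<forall>i. v $ i \<in> subdiff (f i) (u $ i))"
proof
  assume v: "v \<in> subdiff (separable_sum f) u"
  then obtain a where a: "separable_sum f u = ereal a" by (rule subdiff_finite)
  have "f i (u $ i) \<noteq> \<infinity>" for i using a separable_sum_infinity[of f i u] by auto
  then have "\<forall>i. \<exists>r. f i (u $ i) = ereal r" using proper_fun_real[OF P] by blast
  then obtain r where r: "\<And>i. f i (u $ i) = ereal (r i)" by metis
  have ru: "separable_sum f u = ereal (\<Sum>i\<in>UNIV. r i)" by (rule separable_sum_real) (rule r)
  show "\<forall>i. v $ i \<in> subdiff (f i) (u $ i)"
  proof
    fix k
    have "ereal (r k + v $ k \<bullet> (y - u $ k)) \<le> f k y" for y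
    proof (cases rule: proper_fun_cases[OF P[of k], of y])
      case (2 b)
      \<comment> \<open>Only component \<open>k\<close> is varied, so the other terms of the
        subgradient inequality cancel.\<close>
      define z where "z = (\<chi> i. if i = k then y else u $ i)"
      have "f i (z $ i) = ereal (if i = k then b else r i)" for i by (simp add: z_def 2 r)
      then have z: "separable_sum f z = ereal (\<Sum>i\<in>UNIV. if i = k then b else r i)"
        by (rule separable_sum_real)
      have "(\<Sum>i\<in>UNIV. r i) + v \<bullet> (z - u) \<le> (\<Sum>i\<in>UNIV. if i = k then b else r i)"
        by (rule subdiffD[OF v ru z])
      moreover have "v \<bullet> (z - u) = v $ k \<bullet> (y - u $ k)"
      proof -
        have "v \<bullet> (z - u) = (\<Sum>i\<in>UNIV. if i = k then v $ k \<bullet> (y - u $ k) else 0)"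
          unfolding inner_vec_def by (intro sum.cong) (auto simp: z_def)
        then show ?thesis by simp
      qed
      moreover have "(\<Sum>i\<in>UNIV. r i) = r k + (\<Sum>i\<in>UNIV - {k}. r i)" by (simp add: sum.remove)
      moreover have "(\<Sum>i\<in>UNIV. if i = k then b else r i) = b + (\<Sum>i\<in>UNIV - {k}. r i)"
        by (subst sum.remove[of _ k]) (auto intro!: sum.cong)
      ultimately show ?thesis by (simp add: 2)
    qed simp
    then show "v $ k \<in> subdiff (f k) (u $ k)" by (simp add: subdiff_def r)
  qed
next
  assume v: "\<forall>i. v $ i \<in> subdiff (f i) (u $ i)"
  then have "\<forall>i. \<exists>r. f i (u $ i) = ereal r" by (metis subdiff_finite)
  then obtain r where r: "\<And>i. f i (u $ i) = ereal (r i)" by metis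
  have ru: "separable_sum f u = ereal (\<Sum>i\<in>UNIV. r i)" by (rule separable_sum_real) (rule r)
  have "ereal ((\<Sum>i\<in>UNIV. r i) + v \<bullet> (z - u)) \<le> separable_sum f z" for z
  proof (cases rule: separable_sum_cases[of f z, OF P])
    case (2 q)
    have "(\<Sum>i\<in>UNIV. r i + v $ i \<bullet> (z $ i - u $ i)) \<le> (\<Sum>i\<in>UNIV. q i)"
    proof (rule sum_mono)
      fix i
      show "r i + v $ i \<bullet> (z $ i - u $ i) \<le> q i"
        using v r[of i] 2(1)[of i] by (intro subdiffD[of _ "f i"]) auto
    qed
    then show ?thesis by (simp add: 2(2) sum.distrib inner_vec_def)
  qed simp
  then show "v \<in> subdiff (separable_sum f) u" by (simp add: subdiff_def ru)
qed

text \<open>Substituting \<open>u = z + b\<close> moves the shift out of \<open>f\<close> into the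
  smooth quadratic, where Fermat's rule applies.\<close>

lemma is_arg_min_proximal_subdiff:
  fixes f :: "'a::real_inner \<Rightarrow> ereal"
  assumes P: "proper_fun f" and C: "econvex f"
    and min: "is_arg_min (\<lambda>w. f (w + b) + ereal (c \<bullet> w + \<gamma> / 2 * (norm (w - e))\<^sup>2)) (\<lambda>w. True) z"
  shows "\<gamma> *\<^sub>R (e - z) - c \<in> subdiff f (z + b)"
proof -
  define q where "q = (\<lambda>u. c \<bullet> (u - b) + \<gamma> / 2 * (norm (u - b - e))\<^sup>2)"
  have "- (c + \<gamma> *\<^sub>R (z - e)) \<in> subdiff f (z + b)"
  proof (rule smooth_minimizer_subgradient[OF P C])
    fix y
    have "f (z + b) + ereal (c \<bullet> z + \<gamma> / 2 * (norm (z - e))\<^sup>2)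
        \<le> f ((y - b) + b) + ereal (c \<bullet> (y - b) + \<gamma> / 2 * (norm (y - b - e))\<^sup>2)"
      using min by (simp only: is_arg_min_linorder)
    then show "f (z + b) + ereal (q (z + b)) \<le> f y + ereal (q y)" by (simp add: q_def)
  next
    fix h
    have "z + b + h - b - e = (z - e) + h" by simp
    then have eq: "(norm (z + b + h - b - e))\<^sup>2 = (norm (z - e))\<^sup>2 + 2 * ((z - e) \<bullet> h) + (norm h)\<^sup>2"
      by (simp only: norm_add_power2)
    show "q (z + b + h) \<le> q (z + b) + (c + \<gamma> *\<^sub>R (z - e)) \<bullet> h + \<gamma> / 2 * (norm h)\<^sup>2"
      unfolding q_def eq
      by (simp add: inner_add_left inner_add_right inner_diff_left inner_diff_right distrib_left right_diff_distrib)
  qed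
  then show ?thesis by (simp add: algebra_simps)
qed

section \<open>Fenchel duality and existence of multipliers\<close>

lemma primal_value_le: "primal_value f \<le> (\<Sum>i\<in>UNIV. f i x)"
  unfolding primal_value_def by (rule INF_lower) simp

text \<open>As \<open>v\<close> is orthogonal to the diagonal, its subgradient inequality on
  diagonal vectors expresses optimality of \<open>p\<close>, and equality in Fenchel-Young closes
  the gap. For any other dual solution the zero gap forces equality in every summand, so its entries
  are subgradients at the same \<open>p\<close>.\<close>

lemma fenchel_duality:
  fixes f :: "'m::finite \<Rightarrow> 'a::real_inner \<Rightarrow> ereal" and v :: "'a ^ 'm"
  assumes P: "\<And>i. proper_fun (f i)"
    and v: "\<And>i. v $ i \<in> subdiff (f i) p" and sum0: "(\<Sum>i\<in>UNIV. v $ i) = 0"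
  shows "primal_optimal f p" "dual_optimal f v" "primal_value f = dual_value f"
    and "dual_optimal f u \<Longrightarrow> u $ i \<in> subdiff (f i) p"
proof -
  have "\<forall>i. \<exists>r. f i p = ereal r" using v by (metis subdiff_finite)
  then obtain r where r: "\<And>i. f i p = ereal (r i)" by metis
  have zero: "(\<Sum>i\<in>UNIV. u $ i \<bullet> p) = 0" if "(\<Sum>i\<in>UNIV. u $ i) = 0" for u :: "'a ^ 'm"
    using that by (simp flip: inner_sum_left)
  have fp: "(\<Sum>i\<in>UNIV. f i p) = ereal (\<Sum>i\<in>UNIV. r i)" by (simp add: r)
  have "ereal (\<Sum>i\<in>UNIV. r i) \<le> (\<Sum>i\<in>UNIV. f i x)" for x
  proof -
    have "v \<in> subdiff (separable_sum f) (\<chi> i. p)"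
      unfolding subdiff_separable_sum[OF P] using v by simp
    then have "separable_sum f (\<chi> i. p) + ereal (v \<bullet> ((\<chi> i. x) - (\<chi> i. p))) \<le> separable_sum f (\<chi> i. x)"
      by (simp add: subdiff_def)
    moreover have "v \<bullet> ((\<chi> i. x) - (\<chi> i. p)) = 0"
      using sum0 by (simp add: inner_vec_def flip: inner_sum_left)
    ultimately show ?thesis by (simp add: separable_sum_def r)
  qed
  then have primal: "primal_value f = ereal (\<Sum>i\<in>UNIV. r i)"
    unfolding primal_value_def by (intro antisym INF_greatest) (auto intro!: INF_lower2[of p] simp: r)
  then show "primal_optimal f p" by (simp add: primal_optimal_def fp)
  have conj_low: "ereal (u $ i \<bullet> p - r i) \<le> conjugate (f i) (u $ i)" for u :: "'a ^ 'm" and i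
    using conjugate_ge[of "u $ i" p "f i"] by (simp add: r)
  have weak: "- (\<Sum>i\<in>UNIV. conjugate (f i) (u $ i)) \<le> ereal (\<Sum>i\<in>UNIV. r i)"
    if "(\<Sum>i\<in>UNIV. u $ i) = 0" for u :: "'a ^ 'm"
  proof -
    have "ereal (\<Sum>i\<in>UNIV. u $ i \<bullet> p - r i) \<le> (\<Sum>i\<in>UNIV. conjugate (f i) (u $ i))"
      unfolding sum_ereal[symmetric] by (intro sum_mono conj_low)
    then have "- (\<Sum>i\<in>UNIV. conjugate (f i) (u $ i)) \<le> - ereal (\<Sum>i\<in>UNIV. u $ i \<bullet> p - r i)"
      by (simp only: ereal_minus_le_minus)
    then show ?thesis by (simp add: sum_subtractf zero[OF that])
  qed
  have conj_v: "conjugate (f i) (v $ i) = ereal (v $ i \<bullet> p - r i)" for i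
    by (rule conjugate_subdiff[OF v r])
  have attained: "- (\<Sum>i\<in>UNIV. conjugate (f i) (v $ i)) = ereal (\<Sum>i\<in>UNIV. r i)"
    by (simp add: conj_v sum_subtractf zero[OF sum0])
  have dual: "dual_value f = ereal (\<Sum>i\<in>UNIV. r i)"
    unfolding dual_value_def
  proof (rule antisym)
    show "(SUP v\<in>{v :: 'a ^ 'm. (\<Sum>i\<in>UNIV. v $ i) = 0}. - (\<Sum>i\<in>UNIV. conjugate (f i) (v $ i))) \<le> ereal (\<Sum>i\<in>UNIV. r i)"
      by (intro SUP_least weak) simp
    show "ereal (\<Sum>i\<in>UNIV. r i) \<le> (SUP v\<in>{v :: 'a ^ 'm. (\<Sum>i\<in>UNIV. v $ i) = 0}. - (\<Sum>i\<in>UNIV. conjugate (f i) (v $ i)))"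
      unfolding attained[symmetric] using sum0 by (intro SUP_upper) simp
  qed
  show "primal_value f = dual_value f" by (simp add: primal dual)
  show "dual_optimal f v" by (simp add: dual_optimal_def sum0 attained dual)
  show "u $ i \<in> subdiff (f i) p" if u: "dual_optimal f u"
  proof -
    have u0: "(\<Sum>i\<in>UNIV. u $ i) = 0" and eq: "- (\<Sum>i\<in>UNIV. conjugate (f i) (u $ i)) = ereal (\<Sum>i\<in>UNIV. r i)"
      using u by (auto simp: dual_optimal_def dual)
    have "conjugate (f i) (u $ i) \<noteq> \<infinity>" for i
    proof
      assume "conjugate (f i) (u $ i) = \<infinity>"
      then have "(\<Sum>i\<in>UNIV. conjugate (f i) (u $ i)) = \<infinity>" by (auto simp: sum_Pinfty)
      then show False using eq by simp
    qed
    then have "\<forall>i. \<exists>c. conjugate (f i) (u $ i) = ereal c"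
      using conj_low[of u] by (metis ereal_cases ereal_infty_less_eq(2) ereal.distinct(3))
    then obtain c where c: "\<And>i. conjugate (f i) (u $ i) = ereal (c i)" by metis
    have le: "u $ i \<bullet> p - r i \<le> c i" for i using conj_low[of u i] by (simp add: c)
    have "(\<Sum>i\<in>UNIV. u $ i \<bullet> p - r i) = (\<Sum>i\<in>UNIV. c i)"
      using eq by (simp add: c sum_subtractf zero[OF u0])
    then have "u $ i \<bullet> p - r i = c i"
      by (rule sum_mono_inv) (use le in auto)
    then show ?thesis by (intro subdiff_of_conjugate_le[of "f i" p "r i"]) (simp_all add: c r)
  qed
qed

text \<open>The interiority condition provides the closed subspace \<open>V\<close> for
  \<open>subdiff_orthogonal_exists\<close>; a multiplier orthogonal to the diagonal is a family with
  sum 0.\<close>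

lemma sqri_subdiff_exists:
  fixes f :: "'m::finite \<Rightarrow> 'a::{real_inner, complete_space} \<Rightarrow> ereal"
  assumes G: "\<And>i. f i \<in> Gamma_class" and opt: "primal_optimal f p"
    and sqri: "0 \<in> sqri {u - (\<chi> i. p) |(u :: 'a ^ 'm) p. \<forall>i. u $ i \<in> edom (f i)}"
  shows "\<exists>v. (\<forall>i. v $ i \<in> subdiff (f i) p) \<and> (\<Sum>i\<in>UNIV. v $ i) = 0"
proof -
  have P: "\<And>i. proper_fun (f i)" using G by (auto simp: Gamma_class_def)
  define S where "S = {u - (\<chi> i. p) |(u :: 'a ^ 'm) p. \<forall>i. u $ i \<in> edom (f i)}"
  define V where "V = (\<Union>c\<in>{0<..}. {c *\<^sub>R (s - 0) |s. s \<in> S})"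
  have V: "closed V" "subspace V" and "0 \<in> S"
    using sqri unfolding S_def[symmetric] sqri_def V_def by (auto simp: Let_def)
  have edom_iff: "(\<forall>i. u $ i \<in> edom (f i)) \<longleftrightarrow> separable_sum f u \<noteq> \<infinity>" for u
    unfolding separable_sum_def edom_def by (auto simp: sum_Pinfty less_top)
  have S: "v \<in> S \<longleftrightarrow> (\<exists>u d. separable_sum f u \<noteq> \<infinity> \<and> diagonal_proj d = d \<and> v = u - d)" for v
  proof
    assume "v \<in> S"
    then obtain u q where "separable_sum f u \<noteq> \<infinity>" "v = u - (\<chi> i. q)" unfolding S_def edom_iff by blast
    then show "\<exists>u d. separable_sum f u \<noteq> \<infinity> \<and> diagonal_proj d = d \<and> v = u - d"
      using diagonal_proj_const by blast
  next
    assume "\<exists>u d. separable_sum f u \<noteq> \<infinity> \<and> diagonal_proj d = d \<and> v = u - d"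
    then obtain u d where "separable_sum f u \<noteq> \<infinity>" "diagonal_proj d = d" "v = u - d" by blast
    moreover obtain q where "d = (\<chi> i. q)" using diagonal_proj_fixed[OF \<open>diagonal_proj d = d\<close>] by blast
    ultimately show "v \<in> S" unfolding S_def edom_iff by blast
  qed
  have diag: "separable_sum f (\<chi> i. q) = (\<Sum>i\<in>UNIV. f i q)" for q
    by (simp add: separable_sum_def)
  \<comment> \<open>\<open>primal_optimal\<close> alone allows an infinite value;
    \<open>0 \<in> S\<close> gives a diagonal point in the domain and rules this out.\<close>
  have fin: "separable_sum f (\<chi> i. p) \<noteq> \<infinity>"
  proof -
    obtain u d where ud: "separable_sum f u \<noteq> \<infinity>" "diagonal_proj d = d" "0 = u - d"
      using \<open>0 \<in> S\<close> unfolding S by blast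
    then obtain q where "u = (\<chi> i. q)" using diagonal_proj_fixed by fastforce
    then have "(\<Sum>i\<in>UNIV. f i p) \<le> separable_sum f u"
      using opt primal_value_le[of f q] by (simp add: diag primal_optimal_def)
    then show ?thesis using ud(1) by (auto simp: diag)
  qed
  have "\<exists>v. v \<in> subdiff (separable_sum f) (\<chi> i. p) \<and> diagonal_proj v = 0"
  proof (rule diag.subdiff_orthogonal_exists[OF separable_sum_Gamma_class[OF G] _ fin _ V(2,1)])
    show "diagonal_proj (\<chi> i. p) = (\<chi> i. p)" by simp
    fix z :: "'a ^ 'm" assume "diagonal_proj z = z"
    then obtain q where "z = (\<chi> i. q)" using diagonal_proj_fixed by blast
    then show "separable_sum f (\<chi> i. p) \<le> separable_sum f z"
      using opt primal_value_le[of f q] by (simp add: diag primal_optimal_def)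
  next
    fix s d :: "'a ^ 'm" assume "separable_sum f s \<noteq> \<infinity>" "diagonal_proj d = d"
    then have "s - d \<in> S" unfolding S by blast
    then have "1 *\<^sub>R (s - d - 0) \<in> V" unfolding V_def by (intro UN_I[of 1]) auto
    then show "s - d \<in> V" by simp
  next
    fix v assume "v \<in> V"
    then obtain c s where "c > 0" "s \<in> S" "v = c *\<^sub>R s" unfolding V_def by auto
    then show "\<exists>c>0. \<exists>s d. separable_sum f s \<noteq> \<infinity> \<and> diagonal_proj d = d \<and> v = c *\<^sub>R (s - d)"
      unfolding S by blast
  qed
  then obtain v where "v \<in> subdiff (separable_sum f) (\<chi> i. p)" "diagonal_proj v = 0" by blast
  then show ?thesis
    unfolding subdiff_separable_sum[OF P] diagonal_proj_eq_0_iff by auto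
qed

lemma weakly_converges_nth:
  assumes "weakly_converges X l"
  shows "weakly_converges (\<lambda>n. X n $ i) (l $ i)"
  unfolding weakly_converges_def
proof
  fix u
  have "(\<lambda>n. X n \<bullet> axis i u) \<longlonglongrightarrow> l \<bullet> axis i u" using assms by (simp add: weakly_converges_def)
  then show "(\<lambda>n. X n $ i \<bullet> u) \<longlonglongrightarrow> l $ i \<bullet> u" by (simp add: inner_axis)
qed

text \<open>Limits ignore finitely many terms, so the claims are stated for whole sequences although
  the recursions say nothing about \<open>x 0\<close>, \<open>x 1\<close>, \<open>zbar 0\<close> and
  \<open>zbar 1\<close>.\<close>

theorem theorem18:
  fixes f :: "'m::finite \<Rightarrow> 'a::{real_inner, complete_space} \<Rightarrow> ereal"
    and x :: "nat \<Rightarrow> 'a"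
    and y z zbar :: "nat \<Rightarrow> 'a ^ 'm"
    and \<alpha>s lam :: "nat \<Rightarrow> real"
    and \<alpha> lam_min \<sigma> \<delta> \<gamma> :: real
  assumes "CARD('m) \<ge> 2"
    and "\<forall>i. f i \<in> Gamma_class"
    and "\<exists>p. primal_optimal f p"
    and "0 \<in> sqri {u - (\<chi> i. p) |(u :: 'a ^ 'm) p. \<forall>i. u $ i \<in> edom (f i)}"
    and "\<gamma> > 0"
    and "mono_on {1..} \<alpha>s"
    and "\<forall>k\<ge>2. 0 \<le> \<alpha>s k \<and> \<alpha>s k \<le> \<alpha>" and "\<alpha> < 1"
    and "lam_min > 0" and "\<sigma> > 0" and "\<delta> > 0"
    and "\<delta> > (\<alpha>\<^sup>2 * (1 + \<alpha>) + \<alpha> * \<sigma>) / (1 - \<alpha>\<^sup>2)"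
    and "\<forall>k\<ge>2. lam_min \<le> lam k \<and>
           lam k \<le> 2 * ((\<delta> - \<alpha> * (\<alpha> * (1 + \<alpha>) + \<alpha> * \<delta> + \<sigma>)) /
                        (\<delta> * (1 + \<alpha> * (1 + \<alpha>) + \<alpha> * \<delta> + \<sigma>)))"
    and "\<alpha>s 2 = 0 \<or> (lam 1 = 0 \<and> \<alpha>s 1 = 0)"
    and "\<forall>k\<ge>1. x (k + 1) =
           (1 / real CARD('m)) *\<^sub>R (\<Sum>i\<in>UNIV. z k $ i)
           - (1 / (real CARD('m) * \<gamma>)) *\<^sub>R (\<Sum>i\<in>UNIV. y k $ i)
           + (\<alpha>s k / (real CARD('m) * \<gamma>)) *\<^sub>R
               (\<Sum>i\<in>UNIV. y k $ i - y (k - 1) $ i + \<gamma> *\<^sub>R (z k $ i - z (k - 1) $ i))"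
    and "\<forall>k\<ge>1. \<forall>i. zbar (k + 1) $ i =
           (\<alpha>s (k + 1) * lam k) *\<^sub>R (x (k + 1) - z k $ i)
           + ((1 - lam k) * \<alpha>s k * \<alpha>s (k + 1) / \<gamma>) *\<^sub>R
               (y k $ i - y (k - 1) $ i + \<gamma> *\<^sub>R (z k $ i - z (k - 1) $ i))"
    and "\<forall>k\<ge>1. \<forall>i. is_arg_min
           (\<lambda>w. f i (w + zbar (k + 1) $ i)
              + ereal ((- (y k $ i) - ((1 - lam k) * \<alpha>s k) *\<^sub>R
                          (y k $ i - y (k - 1) $ i + \<gamma> *\<^sub>R (z k $ i - z (k - 1) $ i))) \<bullet> w
                       + \<gamma> / 2 * (norm (w - lam k *\<^sub>R x (k + 1) - (1 - lam k) *\<^sub>R (z k $ i)))\<^sup>2))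
           (\<lambda>w. True) (z (k + 1) $ i)"
    and "\<forall>k\<ge>1. \<forall>i. y (k + 1) $ i =
           y k $ i + \<gamma> *\<^sub>R (lam k *\<^sub>R x (k + 1) + (1 - lam k) *\<^sub>R (z k $ i) - z (k + 1) $ i)
           + ((1 - lam k) * \<alpha>s k) *\<^sub>R
               (y k $ i - y (k - 1) $ i + \<gamma> *\<^sub>R (z k $ i - z (k - 1) $ i))"
  shows "\<exists>(p :: 'a) (v :: 'a ^ 'm).
      (\<forall>i. v $ i \<in> subdiff (f i) p) \<and> (\<Sum>i\<in>UNIV. v $ i) = 0 \<and>
      primal_optimal f p \<and> dual_optimal f v \<and> primal_value f = dual_value f \<and>
      weakly_converges x p \<and>
      (\<forall>i. (\<lambda>k. zbar k $ i) \<longlonglongrightarrow> 0) \<and>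
      (\<forall>i. weakly_converges (\<lambda>k. z k $ i) p) \<and>
      (\<forall>i. (\<lambda>k. x (k + 1) - z k $ i) \<longlonglongrightarrow> 0) \<and>
      (\<forall>i. weakly_converges (\<lambda>k. y k $ i) (v $ i)) \<and>
      ((\<forall>i. strongly_convex (conjugate (f i))) \<longrightarrow>
         (\<exists>w. (\<forall>u. dual_optimal f u \<longleftrightarrow> u = w) \<and> y \<longlonglongrightarrow> w)) \<and>
      (\<lambda>k. \<Sum>i\<in>UNIV. f i (z k $ i + zbar k $ i)) \<longlonglongrightarrow> primal_value f \<and>
      (\<lambda>k. - (\<Sum>i\<in>UNIV. conjugate (f i) (y k $ i))) \<longlonglongrightarrow> dual_value f"
proof -
  note x_eq = assms(15)[rule_format] and zbar_eq = assms(16)[rule_format]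
    and z_min = assms(17)[rule_format] and y_eq = assms(18)[rule_format]
  have G: "f i \<in> Gamma_class" and P: "proper_fun (f i)" and C: "econvex (f i)" for i
    using assms(2) by (auto simp: Gamma_class_def)
  have \<gamma>: "\<gamma> > 0" by fact
  \<comment> \<open>The bracket that carries the inertia in the algorithm is \<open>\<gamma>\<close>
    times the increment \<open>d k\<close> of this combined variable.\<close>
  define w where "w = (\<lambda>k. z k + (1 / \<gamma>) *\<^sub>R y k)"
  define d where "d = (\<lambda>k. w k - w (k - 1))"
  have d_nth: "y k $ i - y (k - 1) $ i + \<gamma> *\<^sub>R (z k $ i - z (k - 1) $ i) = \<gamma> *\<^sub>R (d k $ i)" for k i
    using \<gamma> by (simp add: d_def w_def algebra_simps)
  have d_Suc: "d (k + 1) $ i = lam k *\<^sub>R (x (k + 1) - z k $ i) + ((1 - lam k) * \<alpha>s k) *\<^sub>R (d k $ i)"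
    if "k \<ge> 1" for k i
  proof -
    have "\<gamma> *\<^sub>R (d (k + 1) $ i) = y (k + 1) $ i - y k $ i + \<gamma> *\<^sub>R (z (k + 1) $ i - z k $ i)"
      using d_nth[of "k + 1" i] by simp
    also have "\<dots> = \<gamma> *\<^sub>R (lam k *\<^sub>R (x (k + 1) - z k $ i) + ((1 - lam k) * \<alpha>s k) *\<^sub>R (d k $ i))"
      unfolding y_eq[OF that] d_nth by (simp add: algebra_simps)
    finally show ?thesis using \<gamma> by simp
  qed
  have zbar: "zbar (k + 1) = \<alpha>s (k + 1) *\<^sub>R d (k + 1)" if "k \<ge> 1" for k
    unfolding vec_eq_iff
  proof
    fix i
    have "zbar (k + 1) $ i = \<alpha>s (k + 1) *\<^sub>R (d (k + 1) $ i)"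
      unfolding d_Suc[OF that] zbar_eq[OF that] d_nth using \<gamma> by (simp add: scaleR_add_right mult_ac)
    then show "zbar (k + 1) $ i = (\<alpha>s (k + 1) *\<^sub>R d (k + 1)) $ i" by simp
  qed
  have sub: "y (k + 1) \<in> subdiff (separable_sum f) (z (k + 1) + zbar (k + 1))" if "k \<ge> 1" for k
    unfolding subdiff_separable_sum[OF P]
  proof
    fix i
    have "\<gamma> *\<^sub>R (lam k *\<^sub>R x (k + 1) + (1 - lam k) *\<^sub>R (z k $ i) - z (k + 1) $ i)
        - (- (y k $ i) - ((1 - lam k) * \<alpha>s k) *\<^sub>R
              (y k $ i - y (k - 1) $ i + \<gamma> *\<^sub>R (z k $ i - z (k - 1) $ i)))
        \<in> subdiff (f i) (z (k + 1) $ i + zbar (k + 1) $ i)"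
      by (rule is_arg_min_proximal_subdiff[OF P C z_min[OF that, of i, unfolded diff_diff_add]])
    also have "\<gamma> *\<^sub>R (lam k *\<^sub>R x (k + 1) + (1 - lam k) *\<^sub>R (z k $ i) - z (k + 1) $ i)
        - (- (y k $ i) - ((1 - lam k) * \<alpha>s k) *\<^sub>R
              (y k $ i - y (k - 1) $ i + \<gamma> *\<^sub>R (z k $ i - z (k - 1) $ i))) = y (k + 1) $ i"
      unfolding y_eq[OF that] by simp
    finally show "y (k + 1) $ i \<in> subdiff (f i) ((z (k + 1) + zbar (k + 1)) $ i)" by simp
  qed
  \<comment> \<open>The index \<open>n\<close> stands for \<open>k = n + 2\<close>, the first
    \<open>k\<close> at which the parameter bounds hold and the recursion gives
    \<open>zbar k\<close>. \<open>W\<close> is shifted by one only, so that \<open>W (Suc n)\<close>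
    is \<open>w (n + 2)\<close>.\<close>
  define W where "W = (\<lambda>n. w (n + 1))"
  define p where "p = (\<lambda>n. z (n + 2) + zbar (n + 2))"
  define s where "s = (\<lambda>n. p n + (1 / \<gamma>) *\<^sub>R y (n + 2))"
  have dW: "W (Suc n) - W n = d (n + 2)" for n by (simp add: W_def d_def)
  have zbar2: "zbar (n + 2) = \<alpha>s (n + 2) *\<^sub>R (W (Suc n) - W n)" for n
    using zbar[of "n + 1"] by (simp add: dW)
  have s_eq: "s n = W (Suc n) + \<alpha>s (n + 2) *\<^sub>R (W (Suc n) - W n)" for n
    unfolding s_def p_def zbar2 by (simp add: W_def w_def)
  \<comment> \<open>For \<open>k = n + 2\<close>, both sides average the entries of
    \<open>z k\<close> minus \<open>y k\<close> over \<open>\<gamma>\<close> plus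
    \<open>\<alpha>s k\<close> times \<open>d k\<close>.\<close>
  have x_proj: "diagonal_proj (2 *\<^sub>R p n - s n) = (\<chi> i. x (n + 3))" for n
    unfolding vec_eq_iff
  proof
    fix i
    define k where "k = n + 2"
    have k: "k \<ge> 1" by (simp add: k_def)
    have "2 *\<^sub>R p n - s n = z k - (1 / \<gamma>) *\<^sub>R y k + \<alpha>s k *\<^sub>R d k"
      unfolding s_def p_def zbar2 dW k_def by (simp add: scaleR_2)
    then have "diagonal_proj (2 *\<^sub>R p n - s n) $ i
        = (1 / real CARD('m)) *\<^sub>R (\<Sum>j\<in>UNIV. z k $ j - (1 / \<gamma>) *\<^sub>R (y k $ j) + \<alpha>s k *\<^sub>R (d k $ j))"
      by simp
    also have "\<dots> = x (k + 1)"
      unfolding x_eq[OF k] d_nth using \<gamma>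
      by (simp add: sum.distrib sum_subtractf scaleR_sum_right[symmetric] scaleR_add_right scaleR_diff_right)
    finally show "diagonal_proj (2 *\<^sub>R p n - s n) $ i = (\<chi> i. x (n + 3)) $ i"
      by (simp add: k_def eval_nat_numeral)
  qed
  have W_step: "W (Suc (Suc n)) = s n + lam (n + 2) *\<^sub>R (diagonal_proj (2 *\<^sub>R p n - s n) - p n)" for n
    unfolding vec_eq_iff
  proof
    fix i
    define k where "k = n + 2"
    have k: "k \<ge> 1" by (simp add: k_def)
    have "W (Suc (Suc n)) = W (Suc n) + d (k + 1)"
      using dW[of "Suc n"] by (simp add: k_def algebra_simps)
    then have "W (Suc (Suc n)) $ i = W (Suc n) $ i + lam k *\<^sub>R (x (k + 1) - z k $ i) + ((1 - lam k) * \<alpha>s k) *\<^sub>R (d k $ i)"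
      using d_Suc[OF k, of i] by simp
    moreover have "s n $ i = W (Suc n) $ i + \<alpha>s k *\<^sub>R (d k $ i)"
      unfolding s_eq dW k_def by simp
    moreover have "p n $ i = z k $ i + \<alpha>s k *\<^sub>R (d k $ i)"
      unfolding p_def zbar2 dW k_def by simp
    moreover have "x (k + 1) = x (n + 3)" by (simp add: k_def eval_nat_numeral)
    ultimately show "W (Suc (Suc n)) $ i = (s n + lam (n + 2) *\<^sub>R (diagonal_proj (2 *\<^sub>R p n - s n) - p n)) $ i"
      unfolding x_proj k_def[symmetric] by (simp add: algebra_simps)
  qed
  obtain xb where xb: "primal_optimal f xb" using assms(3) by blast
  obtain vb where vb: "\<And>i. vb $ i \<in> subdiff (f i) xb" "(\<Sum>i\<in>UNIV. vb $ i) = 0"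
    using sqri_subdiff_exists[OF G xb assms(4)] by blast
  have vb_sub: "vb \<in> subdiff (separable_sum f) (\<chi> i. xb)"
    unfolding subdiff_separable_sum[OF P] using vb(1) by simp
  have Y_sub: "y (n + 2) \<in> subdiff (separable_sum f) (p n)" for n
    using sub[of "n + 1"] by (simp add: p_def)
  have Y_eq: "y (n + 2) = \<gamma> *\<^sub>R (s n - p n)" for n
    using \<gamma> by (simp add: s_def)
  obtain pb v where pv: "v \<in> subdiff (separable_sum f) pb" "diagonal_proj pb = pb" "diagonal_proj v = 0"
    and weak_p: "weakly_converges p pb" and weak_y: "weakly_converges (\<lambda>n. y (n + 2)) v"
    and ext0: "(\<lambda>n. \<alpha>s (n + 2) *\<^sub>R (W (Suc n) - W n)) \<longlonglongrightarrow> 0"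
    and res0: "(\<lambda>n. diagonal_proj (2 *\<^sub>R p n - s n) - p n) \<longlonglongrightarrow> 0"
    and inner0: "(\<lambda>n. y (n + 2) \<bullet> (p n - pb)) \<longlonglongrightarrow> 0"
  proof (rule diag.inertial_douglas_rachford[where F = "separable_sum f" and \<gamma> = \<gamma> and vb = vb
        and xb = "\<chi> i. xb" and Y = "\<lambda>n. y (n + 2)" and p = p and s = s and w = W
        and a = "\<lambda>n. \<alpha>s (n + 2)" and l = "\<lambda>n. lam (n + 2)" and \<alpha> = \<alpha> and \<delta> = \<delta> and \<sigma> = \<sigma> and m = lam_min])
    show "separable_sum f \<in> Gamma_class" by (rule separable_sum_Gamma_class) (rule G)
    show "diagonal_proj (\<chi> i. xb) = (\<chi> i. xb)" "diagonal_proj vb = 0"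
      using vb(2) by (simp_all add: diagonal_proj_eq_0_iff)
    show "\<alpha>s (n + 2) \<le> \<alpha>s (Suc n + 2)" for n
      using assms(6) by (rule mono_onD) auto
    show "0 \<le> \<alpha>s (n + 2)" "\<alpha>s (n + 2) \<le> \<alpha>" for n
      using assms(7)[rule_format, of "n + 2"] by auto
    show "lam_min \<le> lam (n + 2)"
      "lam (n + 2) \<le> 2 * ((\<delta> - \<alpha> * (\<alpha> * (1 + \<alpha>) + \<alpha> * \<delta> + \<sigma>)) /
                        (\<delta> * (1 + \<alpha> * (1 + \<alpha>) + \<alpha> * \<delta> + \<sigma>)))" for n
      using assms(13)[rule_format, of "n + 2"] by auto
  qed (rule \<gamma> vb_sub Y_sub Y_eq s_eq W_step assms(8-11) | blast)+
  obtain pp where pb: "pb = (\<chi> i. pp)" using diagonal_proj_fixed[OF pv(2)] by blast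
  have v: "v $ i \<in> subdiff (f i) pp" for i using pv(1) unfolding subdiff_separable_sum[OF P] pb by simp
  have v0: "(\<Sum>i\<in>UNIV. v $ i) = 0" using pv(3) by (simp add: diagonal_proj_eq_0_iff)
  note duality = fenchel_duality[of f v pp, OF P v v0]
  have zbar0: "(\<lambda>k. zbar k $ i) \<longlonglongrightarrow> 0" for i
    by (rule LIMSEQ_offset[of _ 2]) (use tendsto_vec_nth[OF ext0, of i] in \<open>simp only: zbar2[symmetric] zero_index\<close>)
  have weak_p_nth: "weakly_converges (\<lambda>n. p n $ i) pp" for i
    using weakly_converges_nth[OF weak_p, of i] by (simp add: pb)
  have res_nth: "(\<lambda>n. x (n + 3) - p n $ i) \<longlonglongrightarrow> 0" for i
    using tendsto_vec_nth[OF res0, of i] by (simp add: x_proj)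
  have weak_x: "weakly_converges x pp"
  proof (rule weakly_converges_offset)
    fix i :: 'm
    show "weakly_converges (\<lambda>n. x (n + 3)) pp"
      using weakly_converges_add_null[OF weak_p_nth res_nth, of i i] by simp
  qed
  have zbar_offset: "(\<lambda>n. zbar (n + 2) $ i) \<longlonglongrightarrow> 0" for i
    using zbar0[of i] by (rule LIMSEQ_ignore_initial_segment)
  have zbar_neg: "(\<lambda>n. - (zbar (n + 2) $ i)) \<longlonglongrightarrow> 0" for i
    using tendsto_minus[OF zbar_offset[of i]] by simp
  have weak_z: "weakly_converges (\<lambda>k. z k $ i) pp" for i
    by (rule weakly_converges_offset[of _ 2])
      (use weakly_converges_add_null[OF weak_p_nth zbar_neg, of i i] in \<open>simp add: p_def\<close>)
  have x_z: "(\<lambda>k. x (k + 1) - z k $ i) \<longlonglongrightarrow> 0" for i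
    by (rule LIMSEQ_offset[of _ 2])
      (use tendsto_add[OF res_nth[of i] zbar_offset[of i]] in \<open>simp add: p_def eval_nat_numeral\<close>)
  have weak_y_nth: "weakly_converges (\<lambda>k. y k $ i) (v $ i)" for i
    by (rule weakly_converges_offset[OF weakly_converges_nth[OF weak_y]])
  have lim_values: "(\<lambda>n. separable_sum f (p n)) \<longlonglongrightarrow> separable_sum f pb"
    by (rule diag.values_tendsto[OF pv(1) Y_sub weak_p inner0])
  have primal: "primal_value f = separable_sum f pb"
    using duality(1) by (simp add: primal_optimal_def separable_sum_def pb)
  have lim_primal: "(\<lambda>k. \<Sum>i\<in>UNIV. f i (z k $ i + zbar k $ i)) \<longlonglongrightarrow> primal_value f"
    unfolding primal
    by (rule LIMSEQ_offset[of _ 2]) (use lim_values in \<open>simp add: separable_sum_def p_def\<close>)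
  have y_pb: "(\<lambda>n. y (n + 2) \<bullet> pb) \<longlonglongrightarrow> 0"
  proof -
    have "v \<bullet> pb = 0" using diag.inner_range_kernel[OF pv(2,3)] by (simp add: inner_commute)
    then show ?thesis using weak_y unfolding weakly_converges_def by metis
  qed
  have y_p: "(\<lambda>n. y (n + 2) \<bullet> p n) \<longlonglongrightarrow> 0"
    using tendsto_add[OF inner0 y_pb] by (simp add: inner_diff_right)
  \<comment> \<open>Equality in Fenchel-Young turns the dual objective at \<open>y (n + 2)\<close>
    into the primal one at \<open>p n\<close> minus an inner product that vanishes.\<close>
  have lim_dual: "(\<lambda>k. - (\<Sum>i\<in>UNIV. conjugate (f i) (y k $ i))) \<longlonglongrightarrow> dual_value f"
  proof (rule LIMSEQ_offset[of _ 2])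
    have eq: "- (\<Sum>i\<in>UNIV. conjugate (f i) (y (n + 2) $ i)) = separable_sum f (p n) - ereal (y (n + 2) \<bullet> p n)" for n
    proof -
      have Yi: "y (n + 2) $ i \<in> subdiff (f i) (p n $ i)" for i
        using Y_sub[of n] unfolding subdiff_separable_sum[OF P] by blast
      then have "\<forall>i. \<exists>r. f i (p n $ i) = ereal r" by (metis subdiff_finite)
      then obtain r where r: "\<And>i. f i (p n $ i) = ereal (r i)" by metis
      have "conjugate (f i) (y (n + 2) $ i) = ereal (y (n + 2) $ i \<bullet> p n $ i - r i)" for i
        by (rule conjugate_subdiff) (rule Yi, rule r)
      moreover have "separable_sum f (p n) = ereal (\<Sum>i\<in>UNIV. r i)"
        by (rule separable_sum_real) (rule r)
      ultimately show ?thesis by (simp add: inner_vec_def sum_subtractf)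
    qed
    obtain b where b: "separable_sum f pb = ereal b" using pv(1) by (rule subdiff_finite)
    have "(\<lambda>n. separable_sum f (p n) - ereal (y (n + 2) \<bullet> p n)) \<longlonglongrightarrow> separable_sum f pb - ereal 0"
      by (intro tendsto_diff_ereal lim_values tendsto_ereal y_p) (simp_all add: b)
    then show "(\<lambda>n. - (\<Sum>i\<in>UNIV. conjugate (f i) (y (n + 2) $ i))) \<longlonglongrightarrow> dual_value f"
      unfolding eq duality(3)[symmetric] primal by simp
  qed
  have strong: "\<exists>w. (\<forall>u. dual_optimal f u \<longleftrightarrow> u = w) \<and> y \<longlonglongrightarrow> w"
    if "\<forall>i. strongly_convex (conjugate (f i))"
  proof -
    have "\<forall>i. \<exists>\<beta>>0. \<forall>x y a b. a \<in> subdiff (f i) x \<longrightarrow> b \<in> subdiff (f i) y \<longrightarrow>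
        \<beta> * (norm (a - b))\<^sup>2 \<le> (x - y) \<bullet> (a - b)"
      using that strongly_convex_conjugate_subdiff by blast
    then obtain \<beta> where \<beta>: "\<And>i. \<beta> i > 0" and mono: "\<And>i x y a b. a \<in> subdiff (f i) x \<Longrightarrow> b \<in> subdiff (f i) y \<Longrightarrow>
        \<beta> i * (norm (a - b))\<^sup>2 \<le> (x - y) \<bullet> (a - b)"
      by metis
    \<comment> \<open>Every dual solution consists of subgradients at the same point
      \<open>pp\<close>, where strong monotonicity admits only one.\<close>
    have "dual_optimal f u \<longleftrightarrow> u = v" for u
    proof
      assume u: "dual_optimal f u"
      show "u = v" unfolding vec_eq_iff
      proof
        fix i
        have "\<beta> i * (norm (u $ i - v $ i))\<^sup>2 \<le> (pp - pp) \<bullet> (u $ i - v $ i)"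
          by (rule mono[OF duality(4)[OF u] v])
        then show "u $ i = v $ i" using \<beta>[of i] by (simp add: mult_le_0_iff)
      qed
    qed (use duality(2) in simp)
    moreover have "y \<longlonglongrightarrow> v"
    proof (rule LIMSEQ_offset[of _ 2], rule vec_tendstoI)
      fix i
      have "(\<lambda>n. v \<bullet> (p n - pb)) \<longlonglongrightarrow> 0"
      proof -
        have "(\<lambda>n. p n \<bullet> v - pb \<bullet> v) \<longlonglongrightarrow> pb \<bullet> v - pb \<bullet> v"
          using weak_p unfolding weakly_converges_def by (intro tendsto_diff tendsto_const) blast
        then show ?thesis by (simp add: inner_diff_right inner_commute)
      qed
      with inner0 have "(\<lambda>n. (y (n + 2) \<bullet> (p n - pb) - v \<bullet> (p n - pb)) / \<beta> i) \<longlonglongrightarrow> (0 - 0) / \<beta> i"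
        using \<beta>[of i] by (intro tendsto_divide tendsto_diff tendsto_const) auto
      then have lim: "(\<lambda>n. (y (n + 2) \<bullet> (p n - pb) - v \<bullet> (p n - pb)) / \<beta> i) \<longlonglongrightarrow> 0" by simp
      \<comment> \<open>A single component is bounded by the whole inner product because
        monotonicity makes the other summands nonnegative.\<close>
      have le: "(norm (y (n + 2) $ i - v $ i))\<^sup>2 \<le> (y (n + 2) \<bullet> (p n - pb) - v \<bullet> (p n - pb)) / \<beta> i" for n
      proof -
        have ineq: "\<beta> j * (norm (y (n + 2) $ j - v $ j))\<^sup>2 \<le> (p n $ j - pp) \<bullet> (y (n + 2) $ j - v $ j)" for j
          using Y_sub[of n] v[of j] unfolding subdiff_separable_sum[OF P] by (intro mono) auto
        have "0 \<le> (p n $ j - pp) \<bullet> (y (n + 2) $ j - v $ j)" for j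
          using \<beta>[of j] by (intro order_trans[OF _ ineq]) simp
        then have "(p n $ i - pp) \<bullet> (y (n + 2) $ i - v $ i) \<le> (\<Sum>j\<in>UNIV. (p n $ j - pp) \<bullet> (y (n + 2) $ j - v $ j))"
          by (intro member_le_sum) auto
        also have "\<dots> = (p n - pb) \<bullet> (y (n + 2) - v)" by (simp add: inner_vec_def pb)
        also have "\<dots> = y (n + 2) \<bullet> (p n - pb) - v \<bullet> (p n - pb)"
          by (simp only: inner_diff_right inner_commute[of "p n - pb"])
        finally show ?thesis using ineq[of i] \<beta>[of i] by (simp add: pos_le_divide_eq mult.commute)
      qed
      have "(\<lambda>n. (norm (y (n + 2) $ i - v $ i))\<^sup>2) \<longlonglongrightarrow> 0"
        by (rule Lim_null_comparison[OF always_eventually lim]) (simp only: real_norm_def abs_power2 le simp_thms)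
      then have "(\<lambda>n. sqrt ((norm (y (n + 2) $ i - v $ i))\<^sup>2)) \<longlonglongrightarrow> sqrt 0" by (rule tendsto_real_sqrt)
      then have "(\<lambda>n. y (n + 2) $ i - v $ i) \<longlonglongrightarrow> 0" by (simp add: tendsto_norm_zero_iff)
      then show "(\<lambda>n. y (n + 2) $ i) \<longlonglongrightarrow> v $ i" by (rule LIM_zero_cancel)
    qed
    ultimately show ?thesis by blast
  qed
  show ?thesis
    using v v0 duality(1-3) weak_x zbar0 weak_z x_z weak_y_nth strong lim_primal lim_dual
    by (intro exI[of _ pp] exI[of _ v] conjI) auto
qed

end
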